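(* Let $X$ be a quasi-Banach function space over $\mathbf{R}^d$. If $X\in A_{\mathrm{sparse}}$, then there is an $r_0>1$ such that for every $1<r\le r_0$ we have $X^r\in A_{\mathrm{sparse}}$ and \[[X^r]_{A_{\mathrm{sparse}}}^{1/r}\lesssim_{d,K_X}[X]_{A_{\mathrm{sparse}}}.\]
   Context: Cubes are axis-parallel cubes in $\mathbf{R}^d$. A quasi-Banach function space over $\mathbf{R}^d$ is a complete quasi-normed space $X\subseteq L^0(\mathbf{R}^d)$ with the ideal property (if $f\in X$, $|g|\le|f|$ then $g\in X$, $\|g\|_X\le\|f\|_X$) and the saturation property (every set of positive measure contains a subset $F$ of positive measure with $\mathbf{1}_F\in X$). $K_X\ge1$ is the optimal constant with $\|f+g\|_X\le K_X(\|f\|_X+\|g\|_X)$. For $0<p<\infty$, $X^p=\{f:|f|^{1/p}\in X\}$, $\|f\|_{X^p}=\||f|^{1/p}\|_X^p$. A collection $\mathcal{S}$ of cubes is sparse if there are pairwise disjoint $E_Q\subseteq Q$ with $|E_Q|\ge\frac12|Q|$. With $A_{\mathcal{S}}f=\sum_{Q\in\mathcal{S}}\big(\frac1{|Q|}\int_Q|f|\big)\mathbf{1}_Q$, $Y\in A_{\mathrm{sparse}}$ means there is $C$ with $\|A_{\mathcal{S}}f\|_Y\le C\|f\|_Y$ for every sparse $\mathcal{S}$ and $f\in Y$; the least $C$ is $[Y]_{A_{\mathrm{sparse}}}$. *)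

theory Defs
  imports "HOL-Analysis.Analysis"
begin

definition cubes :: "'a::euclidean_space set set" where
  "cubes = {Q. \<exists>a h. h > 0 \<and> Q = cbox a (a + h *\<^sub>R One)}"

definition sparse :: "'a::euclidean_space set set \<Rightarrow> bool" where
  "sparse S \<longleftrightarrow> S \<subseteq> cubes \<and>
     (\<exists>E. (\<forall>Q\<in>S. E Q \<in> sets lebesgue \<and> E Q \<subseteq> Q \<and>
                 measure lebesgue (E Q) \<ge> 1/2 * measure lebesgue Q) \<and>
          (\<forall>Q\<in>S. \<forall>Q'\<in>S. Q \<noteq> Q' \<longrightarrow> E Q \<inter> E Q' = {}))"

definition avg :: "'a::euclidean_space set \<Rightarrow> ('a \<Rightarrow> real) \<Rightarrow> ennreal" where
  "avg Q f = (\<integral>\<^sup>+ y\<in>Q. ennreal \<bar>f y\<bar> \<partial>lebesgue) / emeasure lebesgue Q"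

definition sparse_op :: "'a::euclidean_space set set \<Rightarrow> ('a \<Rightarrow> real) \<Rightarrow> 'a \<Rightarrow> ennreal" where
  "sparse_op S f x = (\<integral>\<^sup>+ Q. avg Q f * indicator Q x \<partial>count_space S)"

definition qBFS :: "('a::euclidean_space \<Rightarrow> real) set \<Rightarrow> (('a \<Rightarrow> real) \<Rightarrow> real) \<Rightarrow> bool" where
  "qBFS X nX \<longleftrightarrow>
     X \<subseteq> borel_measurable lebesgue \<and>
     (\<forall>f\<in>X. nX f \<ge> 0) \<and>
     (\<forall>f\<in>X. nX f = 0 \<longleftrightarrow> (AE x in lebesgue. f x = 0)) \<and>
     (\<forall>f\<in>X. \<forall>c. (\<lambda>x. c * f x) \<in> X \<and> nX (\<lambda>x. c * f x) = \<bar>c\<bar> * nX f) \<and>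
     (\<exists>K\<ge>1. \<forall>f\<in>X. \<forall>g\<in>X. (\<lambda>x. f x + g x) \<in> X \<and>
                 nX (\<lambda>x. f x + g x) \<le> K * (nX f + nX g)) \<and>
     (\<forall>f\<in>X. \<forall>g\<in>borel_measurable lebesgue. (AE x in lebesgue. \<bar>g x\<bar> \<le> \<bar>f x\<bar>)
          \<longrightarrow> g \<in> X \<and> nX g \<le> nX f) \<and>
     (\<forall>E\<in>sets lebesgue. emeasure lebesgue E > 0 \<longrightarrow>
          (\<exists>F\<in>sets lebesgue. F \<subseteq> E \<and> emeasure lebesgue F > 0 \<and> indicator F \<in> X)) \<and>
     (\<forall>u. (\<forall>n. u n \<in> X) \<and>
          (\<forall>e>0. \<exists>N. \<forall>m\<ge>N. \<forall>n\<ge>N. nX (\<lambda>x. u m x - u n x) < e) \<longrightarrow>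
          (\<exists>f\<in>X. (\<lambda>n. nX (\<lambda>x. u n x - f x)) \<longlonglongrightarrow> 0))"

definition KX :: "('a \<Rightarrow> real) set \<Rightarrow> (('a \<Rightarrow> real) \<Rightarrow> real) \<Rightarrow> real" where
  "KX X nX = Inf {K. K \<ge> 1 \<and> (\<forall>f\<in>X. \<forall>g\<in>X. nX (\<lambda>x. f x + g x) \<le> K * (nX f + nX g))}"

definition pow_space :: "('a::euclidean_space \<Rightarrow> real) set \<Rightarrow> real \<Rightarrow> ('a \<Rightarrow> real) set" where
  "pow_space X p = {f \<in> borel_measurable lebesgue. (\<lambda>x. \<bar>f x\<bar> powr (1/p)) \<in> X}"

definition pow_norm :: "(('a \<Rightarrow> real) \<Rightarrow> real) \<Rightarrow> real \<Rightarrow> ('a \<Rightarrow> real) \<Rightarrow> real" where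
  "pow_norm nX p f = nX (\<lambda>x. \<bar>f x\<bar> powr (1/p)) powr p"

definition Asparse_bound :: "('a::euclidean_space \<Rightarrow> real) set \<Rightarrow> (('a \<Rightarrow> real) \<Rightarrow> real) \<Rightarrow> real \<Rightarrow> bool" where
  "Asparse_bound Y nY C \<longleftrightarrow>
     (\<forall>S f. sparse S \<and> f \<in> Y \<longrightarrow>
        (AE x in lebesgue. sparse_op S f x < \<infinity>) \<and>
        (\<lambda>x. enn2real (sparse_op S f x)) \<in> Y \<and>
        nY (\<lambda>x. enn2real (sparse_op S f x)) \<le> C * nY f)"

definition in_Asparse :: "('a::euclidean_space \<Rightarrow> real) set \<Rightarrow> (('a \<Rightarrow> real) \<Rightarrow> real) \<Rightarrow> bool" where
  "in_Asparse Y nY \<longleftrightarrow> (\<exists>C. Asparse_bound Y nY C)"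

definition Asparse_const :: "('a::euclidean_space \<Rightarrow> real) set \<Rightarrow> (('a \<Rightarrow> real) \<Rightarrow> real) \<Rightarrow> real" where
  "Asparse_const Y nY = Inf {C. Asparse_bound Y nY C}"

end

(* If g = |f| powr (1/r), the claim is a bound on the sparse operator with r-averages of g.
   The dyadic maximal operator M of 2^d shifted grids dominates all averages over cubes and is
   itself pointwise dominated by sparse operators (over the cubes at which the dyadic averages
   reach a new record scale, seen from above), so M is bounded on X.  The Rubio de Francia
   series w of M-iterates of g satisfies g <= w, M w <= L w and ||w|| <= 2 K^2 ||g||.  Such an
   A_1 weight satisfies a reverse Hoelder inequality <w^r>_Q <= 2 <w>_Q^r once r - 1 is small
   compared with 1/L; the constant 2 does not depend on L, so L only influences r_0.  Hence
   A_S(|f|) <= 2 (A_S w)^r, and A_S w is controlled by the hypothesis on X. *)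

theory Submission
  imports Defs
begin

text \<open>A sparse family may contain arbitrary cubes, and this shapes the setup. The reverse
  Hoelder inequality rests on stopping times, so it needs a nested grid in which the given cube is a
  cell; therefore \<open>dyadic_grid\<close> leaves mesh and offsets open, and a separate grid is
  built for each cube. The A1 condition must instead come from one fixed operator that can be
  iterated. The one-third trick reconciles the two: the shifted grids control the averages over
  cells of any other grid up to a factor \<open>6 ^ DIM('a)\<close>, which only enlarges the A1
  constant. Since \<open>X\<close> carries only a quasi-norm and has no assumed Fatou property,
  infinite sums are not automatic: geometric weights must beat the powers of \<open>K\<close>, and
  the limit comes from completeness. Functions stay \<open>ennreal\<close>-valued as long as
  possible, so that averages, suprema and series need no convergence conditions; finiteness almost
  everywhere is recovered from membership in \<open>X\<close>.\<close>

section \<open>Dyadic grids\<close>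

text \<open>As a simp rule it would rewrite Lebesgue measures into \<open>lborel\<close> measures of
  main parts.\<close>

declare emeasure_completion [simp del]

definition eavg :: "'a::euclidean_space set \<Rightarrow> ('a \<Rightarrow> ennreal) \<Rightarrow> ennreal" where
  "eavg P g = (\<integral>\<^sup>+ y\<in>P. g y \<partial>lebesgue) / emeasure lebesgue P"

text \<open>Two kinds of instances occur: the shifted grids behind the maximal operator, and a grid
  scaled and translated so that a prescribed cube becomes a cell. \<open>off_nested\<close> places
  the corners of the coarser mesh on the finer lattice.\<close>

locale dyadic_grid =
  fixes side :: "int \<Rightarrow> real" and off :: "int \<Rightarrow> 'a::euclidean_space \<Rightarrow> real"
  assumes side_pos: "side n > 0"
    and side_double: "side (n + 1) = 2 * side n"
    and off_nested: "i \<in> Basis \<Longrightarrow> \<exists>j::int. off n i - off (n + 1) i = of_int j * side n"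
begin

definition idx :: "int \<Rightarrow> 'a \<Rightarrow> 'a \<Rightarrow> int" where
  "idx n x i = \<lfloor>(x \<bullet> i - off n i) / side n\<rfloor>"

text \<open>Cells are half-open, so that those of one level partition the space and stopping cells
  can be exactly disjoint. The closed \<open>cube\<close> differs by a null set and serves to meet
  the definition of \<open>cubes\<close>.\<close>

definition cell :: "int \<Rightarrow> 'a \<Rightarrow> 'a set" where
  "cell n x = {y. \<forall>i\<in>Basis. idx n y i = idx n x i}"

definition corner :: "int \<Rightarrow> 'a \<Rightarrow> 'a" where
  "corner n x = (\<Sum>i\<in>Basis. (off n i + of_int (idx n x i) * side n) *\<^sub>R i)"

definition cube :: "int \<Rightarrow> 'a \<Rightarrow> 'a set" where
  "cube n x = cbox (corner n x) (corner n x + side n *\<^sub>R One)"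

lemma mem_cell [simp]: "x \<in> cell n x"
  by (simp add: cell_def)

lemma cell_eq: "y \<in> cell n x \<Longrightarrow> cell n y = cell n x"
  by (auto simp: cell_def)

lemma cube_eq: "y \<in> cell n x \<Longrightarrow> cube n y = cube n x"
  by (simp add: cube_def cell_def corner_def)

text \<open>The coarser index is \<open>(idx n z i + j) div 2\<close> with \<open>j\<close>
  depending only on the offsets, hence a function of the finer index.\<close>

lemma cell_subset_Suc: "cell n x \<subseteq> cell (n + 1) x"
proof
  fix y assume y: "y \<in> cell n x"
  have "idx (n + 1) z i = (idx n z i + j) div 2"
    if i: "i \<in> Basis" and j: "off n i - off (n + 1) i = of_int j * side n" for z i j
  proof -
    have "(z \<bullet> i - off (n + 1) i) / side (n + 1) = ((z \<bullet> i - off n i) / side n + of_int j) / of_int 2"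
      using j side_pos[of n] unfolding side_double by (simp add: field_simps)
    then show ?thesis
      unfolding idx_def by (simp only: floor_divide_real_eq_div) simp
  qed
  note idx_Suc = this
  show "y \<in> cell (n + 1) x"
    unfolding cell_def
  proof (intro CollectI ballI)
    fix i :: 'a assume i: "i \<in> Basis"
    obtain j :: int where "off n i - off (n + 1) i = of_int j * side n"
      using off_nested[OF i] by blast
    from idx_Suc[OF i this] i y show "idx (n + 1) y i = idx (n + 1) x i"
      by (simp add: cell_def)
  qed
qed

lemma cell_mono: "n \<le> m \<Longrightarrow> cell n x \<subseteq> cell m x"
proof (induction m rule: int_ge_induct)
  case (step i)
  then show ?case using cell_subset_Suc[of i x] by blast
qed simp

lemma cell_eq_le: "y \<in> cell n x \<Longrightarrow> n \<le> m \<Longrightarrow> cell m y = cell m x"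
  using cell_eq cell_mono by blast

lemma side_diff: "side (n - int k) = side n / 2 ^ k"
proof (induction k)
  case (Suc k)
  have "side (n - int k) = 2 * side (n - int (Suc k))"
    using side_double[of "n - int (Suc k)"] by (simp add: algebra_simps)
  with Suc show ?case by simp
qed simp

lemma corner_inner: "i \<in> Basis \<Longrightarrow> corner n x \<bullet> i = off n i + of_int (idx n x i) * side n"
  by (simp add: corner_def inner_sum_left inner_Basis if_distrib cong: if_cong)

lemma cell_halfopen:
  "cell n x = {y. \<forall>i\<in>Basis. corner n x \<bullet> i \<le> y \<bullet> i \<and> y \<bullet> i < corner n x \<bullet> i + side n}"
proof -
  have "idx n y i = idx n x i \<longleftrightarrow> corner n x \<bullet> i \<le> y \<bullet> i \<and> y \<bullet> i < corner n x \<bullet> i + side n"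
    if "i \<in> Basis" for y i
    using that side_pos[of n] unfolding corner_inner[OF that] idx_def[of n y] floor_eq_iff
    by (auto simp: field_simps)
  then show ?thesis by (auto simp: cell_def)
qed

lemma cell_subset_cube: "cell n x \<subseteq> cube n x"
  by (auto simp: cell_halfopen cube_def mem_box inner_add_left less_imp_le)

lemma box_subset_cell: "box (corner n x) (corner n x + side n *\<^sub>R One) \<subseteq> cell n x"
  by (auto simp: cell_halfopen mem_box inner_add_left less_imp_le)

text \<open>The difference lies in the frontier of a box, so it is null by completeness;
  measurability of the cells follows from this.\<close>

lemma null_cube_diff_cell: "cube n x - cell n x \<in> null_sets lebesgue"
proof -
  have "cbox (corner n x) (corner n x + side n *\<^sub>R One) - box (corner n x) (corner n x + side n *\<^sub>R One)
      \<in> null_sets lebesgue"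
    using negligible_frontier_interval negligible_iff_null_sets by blast
  then show ?thesis
    by (rule null_sets_completion_subset[rotated]) (use box_subset_cell in \<open>auto simp: cube_def\<close>)
qed

lemma sets_cell [measurable]: "cell n x \<in> sets lebesgue"
proof -
  have "cell n x = cube n x - (cube n x - cell n x)" using cell_subset_cube by blast
  moreover have "cube n x \<in> sets lebesgue" by (simp add: cube_def)
  ultimately show ?thesis using null_cube_diff_cell by (metis null_setsD2 sets.Diff)
qed

lemma emeasure_cube: "emeasure lebesgue (cube n x) = ennreal (side n ^ DIM('a))"
  using side_pos[of n] unfolding cube_def
  by (simp add: emeasure_completion emeasure_lborel_cbox_eq inner_add_left)

lemma emeasure_cell: "emeasure lebesgue (cell n x) = ennreal (side n ^ DIM('a))"
proof -
  have "emeasure lebesgue (cube n x) = emeasure lebesgue (cell n x)"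
    using null_cube_diff_cell[of n x] cell_subset_cube[of n x]
    by (metis Un_Diff_cancel2 emeasure_Un_null_set sets_cell sup.absorb2 Un_commute sup.absorb1)
  then show ?thesis by (simp add: emeasure_cube)
qed

lemma cube_in_cubes: "cube n x \<in> cubes"
  using side_pos[of n] by (auto simp: cube_def cubes_def)

lemma countable_cells: "countable (range (cell n))"
proof -
  have "cell n x = (\<lambda>k. {y. \<forall>i\<in>Basis. idx n y i = k i}) (restrict (idx n x) Basis)" for x
    by (auto simp: cell_def)
  moreover have "restrict (idx n x) Basis \<in> Pi\<^sub>E Basis (\<lambda>_. UNIV)" for x by simp
  ultimately have "range (cell n) \<subseteq> (\<lambda>k. {y. \<forall>i\<in>Basis. idx n y i = k i}) ` (Pi\<^sub>E Basis (\<lambda>_. UNIV))"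
    by blast
  moreover have "countable (Pi\<^sub>E (Basis :: 'a set) (\<lambda>_. UNIV :: int set))"
    by (rule countable_PiE) auto
  ultimately show ?thesis by (rule countable_subset[OF _ countable_image])
qed

lemma set_nn_integral_cube:
  "(\<integral>\<^sup>+ y\<in>cube n x. g y \<partial>lebesgue) = (\<integral>\<^sup>+ y\<in>cell n x. g y \<partial>lebesgue)"
proof (rule nn_integral_cong_AE)
  have "AE y in lebesgue. y \<notin> cube n x - cell n x"
    using null_cube_diff_cell AE_not_in by blast
  then show "AE y in lebesgue. g y * indicator (cube n x) y = g y * indicator (cell n x) y"
    by eventually_elim (use cell_subset_cube in \<open>auto simp: indicator_def\<close>)
qed

lemma eavg_cube: "eavg (cube n x) g = eavg (cell n x) g"
  by (simp add: eavg_def set_nn_integral_cube emeasure_cube emeasure_cell)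

text \<open>Lets an open set be exhausted by cells of bounded level.\<close>

lemma cell_small:
  assumes "open U" "x \<in> U"
  shows "\<exists>m\<le>n. cell m x \<subseteq> U"
proof -
  obtain e where e: "e > 0" "ball x e \<subseteq> U" using assms openE by blast
  obtain k where k: "side n * DIM('a) / e < 2 ^ k" 
    using real_arch_pow[of 2] by auto
  have k': "side (n - int k) * DIM('a) < e"
    using k e by (simp add: side_diff field_simps)
  have "cell (n - int k) x \<subseteq> ball x e"
  proof
    fix y assume y: "y \<in> cell (n - int k) x"
    have "dist x y \<le> (\<Sum>i\<in>Basis. \<bar>(x - y) \<bullet> i\<bar>)"
      by (simp add: dist_norm norm_le_l1)
    also have "\<dots> \<le> (\<Sum>i\<in>(Basis::'a set). side (n - int k))"
    proof (rule sum_mono)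
      fix i :: 'a assume i: "i \<in> Basis"
      have "x \<in> cell (n - int k) x" by simp
      with y i show "\<bar>(x - y) \<bullet> i\<bar> \<le> side (n - int k)"
        unfolding cell_halfopen by (force simp: inner_diff_left)
    qed
    also have "\<dots> < e" using k' by (simp add: mult.commute)
    finally show "y \<in> ball x e" by simp
  qed
  then show ?thesis using e(2) by (intro exI[of _ "n - int k"]) auto
qed

lemma emeasure_cell_pos: "0 < emeasure lebesgue (cell n x)"
  and emeasure_cell_finite: "emeasure lebesgue (cell n x) < \<infinity>"
  using side_pos[of n] by (auto simp: emeasure_cell)

lemma emeasure_cell_Suc: "emeasure lebesgue (cell (n + 1) x) = 2 ^ DIM('a) * emeasure lebesgue (cell n x)"
proof -
  have "ennreal (2 ^ DIM('a)) = 2 ^ DIM('a)" by (simp flip: ennreal_power)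
  then show ?thesis
    using side_pos[of n] by (simp add: emeasure_cell side_double power_mult_distrib ennreal_mult)
qed

text \<open>Doubling: the parent carries at least the same integral and has
  \<open>2 ^ DIM('a)\<close> times the measure. It caps the average over a stopping cell, whose
  parent did not stop.\<close>

lemma eavg_cell_Suc: "eavg (cell n x) g \<le> 2 ^ DIM('a) * eavg (cell (n + 1) x) g"
proof -
  let ?d = "2 ^ DIM('a) :: ennreal" and ?I = "\<integral>\<^sup>+ y\<in>cell (n + 1) x. g y \<partial>lebesgue"
    and ?m = "emeasure lebesgue (cell n x)"
  have "?d = ennreal (2 ^ DIM('a))" by (simp flip: ennreal_power)
  then have d: "?d \<noteq> 0" "?d < top" by simp_all
  have "(\<integral>\<^sup>+ y\<in>cell n x. g y \<partial>lebesgue) \<le> (\<integral>\<^sup>+ y\<in>cell (n + 1) x. g y \<partial>lebesgue)"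
    using cell_subset_Suc[of n x] by (intro nn_integral_mono) (auto simp: indicator_def)
  then have "eavg (cell n x) g \<le> (\<integral>\<^sup>+ y\<in>cell (n + 1) x. g y \<partial>lebesgue) / emeasure lebesgue (cell n x)"
    unfolding eavg_def by (rule divide_right_mono_ennreal)
  also have "\<dots> = ?d / ?d * ?I / ?m"
    using d by simp
  also have "\<dots> = ?d * (?I / (?d * ?m))"
    using d emeasure_cell_finite[of n x]
    by (simp add: divide_ennreal_def ennreal_inverse_mult ac_simps)
  also have "\<dots> = ?d * eavg (cell (n + 1) x) g"
    by (simp add: eavg_def emeasure_cell_Suc)
  finally show ?thesis .
qed

lemma eavg_mult_emeasure:
  "eavg (cell n x) g * emeasure lebesgue (cell n x) = (\<integral>\<^sup>+ y\<in>cell n x. g y \<partial>lebesgue)"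
  using emeasure_cell_pos[of n x] emeasure_cell_finite[of n x]
  by (simp add: eavg_def ennreal_divide_times ennreal_mult_divide_eq)

end

section \<open>Stopping cells and the weak-type estimate\<close>

text \<open>Countable additivity turns an estimate on each stopping cell into one on their union.
  Two measures are allowed so that a density can be compared with Lebesgue measure.\<close>

lemma emeasure_Union_comparison:
  assumes "countable \<W>" "disjoint \<W>" and sets: "\<W> \<subseteq> sets M"
    and N: "sets N = sets M" and A: "A \<in> sets M" and B: "B \<in> sets M"
    and le: "\<And>W. W \<in> \<W> \<Longrightarrow> emeasure M (W \<inter> A) \<le> c * emeasure N (W \<inter> B)"
  shows "emeasure M (\<Union>\<W> \<inter> A) \<le> c * emeasure N (\<Union>\<W> \<inter> B)"
proof -
  have disj: "disjoint_family_on (\<lambda>W. W \<inter> C) \<W>" for C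
    using assms(2) by (auto simp: disjoint_family_on_def disjoint_def)
  have eq: "emeasure L (\<Union>\<W> \<inter> C) = (\<integral>\<^sup>+W. emeasure L (W \<inter> C) \<partial>count_space \<W>)"
    if "sets L = sets M" "C \<in> sets M" for L C
  proof -
    have "\<Union>\<W> \<inter> C = (\<Union>W\<in>\<W>. W \<inter> C)" by blast
    then show ?thesis
      using emeasure_UN_countable[OF _ assms(1) disj, of C L] that sets by (auto simp: subset_iff)
  qed
  have "emeasure M (\<Union>\<W> \<inter> A) = (\<integral>\<^sup>+W. emeasure M (W \<inter> A) \<partial>count_space \<W>)"
    using A by (rule eq[OF refl])
  also have "\<dots> \<le> (\<integral>\<^sup>+W. c * emeasure N (W \<inter> B) \<partial>count_space \<W>)"
    by (intro nn_integral_mono) (simp add: le)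
  also have "\<dots> = c * emeasure N (\<Union>\<W> \<inter> B)"
    by (simp add: nn_integral_cmult eq[OF N B])
  finally show ?thesis .
qed

context dyadic_grid
begin

text \<open>The cap \<open>n\<close> leaves finitely many levels above one where \<open>P\<close>
  holds, so a topmost one exists. By \<open>cong\<close> it is the same for all points of its cell,
  which makes the topmost cells disjoint.\<close>

lemma maximal_cells:
  fixes P :: "int \<Rightarrow> 'a \<Rightarrow> bool"
  assumes cong: "\<And>m y z. z \<in> cell m y \<Longrightarrow> P m z = P m y"
  obtains \<W> where "countable \<W>" "disjoint \<W>" "\<W> \<subseteq> sets lebesgue"
    and "\<Union>\<W> = {y. \<exists>m\<le>n. P m y}"
    and "\<forall>W\<in>\<W>. \<exists>m y. W = cell m y \<and> m \<le> n \<and> P m y \<and> (\<forall>m'. m < m' \<and> m' \<le> n \<longrightarrow> \<not> P m' y)"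
proof -
  define is_top where "is_top m y \<longleftrightarrow> m \<le> n \<and> P m y \<and> (\<forall>m'. m < m' \<and> m' \<le> n \<longrightarrow> \<not> P m' y)" for m y
  define \<W> where "\<W> = {cell m y | m y. is_top m y}"
  have top_unique: "m = m'" if "is_top m y" "is_top m' y" for m m' y
    using that unfolding is_top_def by (meson linorder_neqE)
  have top_cong: "is_top m z" if "is_top m y" "z \<in> cell m y" for m y z
  proof -
    have "P m' z = P m' y" if "m \<le> m'" for m'
      using cong cell_mono[OF that] \<open>z \<in> cell m y\<close> by blast
    then show ?thesis using \<open>is_top m y\<close> by (auto simp: is_top_def)
  qed
  have top_ex: "\<exists>m. is_top m y" if "k \<le> n" "P k y" for k y
  proof -
    define M where "M = Max {m \<in> {k..n}. P m y}"
    have fin: "finite {m \<in> {k..n}. P m y}" by (rule finite_subset[of _ "{k..n}"]) auto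
    have M: "M \<in> {m \<in> {k..n}. P m y}" unfolding M_def using that fin by (intro Max_in) auto
    have "\<not> P m' y" if "M < m'" "m' \<le> n" for m'
    proof
      assume "P m' y"
      with that M have "m' \<in> {m \<in> {k..n}. P m y}" by simp
      then have "m' \<le> M" unfolding M_def using fin by (rule Max_ge[rotated])
      with that show False by simp
    qed
    with M have "is_top M y" unfolding is_top_def by simp
    then show ?thesis ..
  qed
  show ?thesis
  proof
    have "\<W> \<subseteq> (\<Union>m. range (cell m))" by (auto simp: \<W>_def)
    then show "countable \<W>"
      by (rule countable_subset) (auto intro: countable_cells)
    show "disjoint \<W>"
    proof (rule disjointI)
      fix V W assume "V \<in> \<W>" "W \<in> \<W>" "V \<noteq> W"
      then obtain m y m' y' where VW: "V = cell m y" "is_top m y" "W = cell m' y'" "is_top m' y'"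
        by (auto simp: \<W>_def)
      show "V \<inter> W = {}"
      proof (rule ccontr)
        assume "V \<inter> W \<noteq> {}"
        then obtain z where z: "z \<in> cell m y" "z \<in> cell m' y'" using VW by blast
        then have "m = m'" using VW top_cong top_unique by blast
        then show False using z VW cell_eq \<open>V \<noteq> W\<close> by metis
      qed
    qed
    show "\<W> \<subseteq> sets lebesgue" by (auto simp: \<W>_def)
    show "\<Union>\<W> = {y. \<exists>m\<le>n. P m y}"
    proof (intro set_eqI iffI)
      fix z assume "z \<in> \<Union>\<W>"
      then show "z \<in> {y. \<exists>m\<le>n. P m y}"
        by (auto simp: \<W>_def is_top_def dest!: cong)
    next
      fix z assume "z \<in> {y. \<exists>m\<le>n. P m y}"
      then obtain m where "is_top m z" using top_ex by blast
      then show "z \<in> \<Union>\<W>" unfolding \<W>_def using mem_cell by blast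
    qed
    show "\<forall>W\<in>\<W>. \<exists>m y. W = cell m y \<and> m \<le> n \<and> P m y \<and> (\<forall>m'. m < m' \<and> m' \<le> n \<longrightarrow> \<not> P m' y)"
      unfolding \<W>_def is_top_def by blast
  qed
qed

lemma sets_stopped:
  assumes cong: "\<And>m y z. z \<in> cell m y \<Longrightarrow> P m z = P m y"
  shows "{y. \<exists>m\<le>n. P m y} \<in> sets lebesgue"
proof -
  obtain \<W> where "countable \<W>" "disjoint \<W>" "\<W> \<subseteq> sets lebesgue"
    and U: "\<Union>\<W> = {y. \<exists>m\<le>n. P m y}"
    by (rule maximal_cells[where P = P and n = n, OF cong]) blast+
  then show ?thesis unfolding U[symmetric] by (intro sets.countable_Union) auto
qed

lemma eavg_cell_cong: "z \<in> cell m y \<Longrightarrow> eavg (cell m z) g = eavg (cell m y) g"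
  by (simp add: cell_eq)

lemma emeasure_density_cell:
  assumes "g \<in> borel_measurable lebesgue"
  shows "emeasure (density lebesgue g) (cell n x) = eavg (cell n x) g * emeasure lebesgue (cell n x)"
  using assms by (simp add: emeasure_density eavg_mult_emeasure)

text \<open>A topmost cell has average at least \<open>t\<close>, so \<open>t\<close> times its
  measure is at most its integral. Those meeting \<open>cell n x\<close> lie inside it and are
  disjoint, hence the constant 1.\<close>

lemma dyadic_weak_type:
  assumes [measurable]: "g \<in> borel_measurable lebesgue"
  shows "t * emeasure lebesgue (cell n x \<inter> {y. \<exists>m\<le>n. t \<le> eavg (cell m y) g})
    \<le> (\<integral>\<^sup>+ y\<in>cell n x. g y \<partial>lebesgue)"
proof -
  define P where "P m y \<longleftrightarrow> t \<le> eavg (cell m y) g" for m y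
  have cong: "P m z = P m y" if "z \<in> cell m y" for m y z
    using that by (simp add: P_def eavg_cell_cong)
  obtain \<W> where \<W>: "countable \<W>" "disjoint \<W>" "\<W> \<subseteq> sets lebesgue"
    and U: "\<Union>\<W> = {y. \<exists>m\<le>n. P m y}"
    and W: "\<forall>W\<in>\<W>. \<exists>m y. W = cell m y \<and> m \<le> n \<and> P m y \<and> (\<forall>m'. m < m' \<and> m' \<le> n \<longrightarrow> \<not> P m' y)"
    by (rule maximal_cells[where P = P and n = n, OF cong]) blast+
  let ?M = "density lebesgue (\<lambda>_. t)" and ?N = "density lebesgue g"
  have "emeasure ?M (\<Union>\<W> \<inter> cell n x) \<le> 1 * emeasure ?N (\<Union>\<W> \<inter> cell n x)"
  proof (rule emeasure_Union_comparison[OF \<W>(1,2)])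
    fix V assume "V \<in> \<W>"
    then obtain m y where V: "V = cell m y" "m \<le> n" "P m y" using W by blast
    show "emeasure ?M (V \<inter> cell n x) \<le> 1 * emeasure ?N (V \<inter> cell n x)"
    proof (cases "V \<inter> cell n x = {}")
      case False
      then obtain z where z: "z \<in> cell m y" "z \<in> cell n x" using V by blast
      then have "cell m y \<subseteq> cell n x"
        using cell_eq[OF z(1)] cell_eq[OF z(2)] cell_mono[OF V(2), of z] by simp
      then have "V \<inter> cell n x = cell m y" using V by blast
      moreover have "emeasure ?M (cell m y) \<le> emeasure ?N (cell m y)"
        using V(3) emeasure_density_cell[of g m y]
        by (simp add: emeasure_density nn_integral_cmult P_def mult_right_mono)
      ultimately show ?thesis by simp
    qed simp
  qed (use \<W> in auto)
  also have "\<dots> \<le> emeasure ?N (cell n x)"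
    by (auto intro!: emeasure_mono)
  also have "\<dots> = (\<integral>\<^sup>+ y\<in>cell n x. g y \<partial>lebesgue)"
    by (simp add: emeasure_density)
  finally have "emeasure ?M (cell n x \<inter> \<Union>\<W>) \<le> (\<integral>\<^sup>+ y\<in>cell n x. g y \<partial>lebesgue)"
    by (simp add: Int_commute)
  moreover have "\<Union>\<W> \<in> sets lebesgue" unfolding U by (rule sets_stopped[OF cong])
  ultimately show ?thesis
    unfolding U P_def by (simp add: emeasure_density nn_integral_cmult)
qed

text \<open>A one-sided substitute for the Lebesgue differentiation theorem.\<close>

lemma AE_le_of_averages_le:
  assumes g[measurable]: "g \<in> borel_measurable lebesgue" and "t < \<infinity>"
  shows "AE y in lebesgue. y \<in> cell n x \<longrightarrow> (\<forall>m\<le>n. eavg (cell m y) g \<le> t) \<longrightarrow> g y \<le> t"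
proof -
  define P where "P m y \<longleftrightarrow> t < eavg (cell m y) g" for m y
  have congP: "P m z = P m y" if "z \<in> cell m y" for m y z
    using that by (simp add: P_def eavg_cell_cong)
  define B where "B = cell n x \<inter> {y. t < g y} - {y. \<exists>m\<le>n. P m y}"
  have [measurable]: "{y. \<exists>m\<le>n. P m y} \<in> sets lebesgue" by (rule sets_stopped[OF congP])
  have "{y \<in> space lebesgue. t < g y} \<in> sets lebesgue" by measurable
  then have B[measurable]: "B \<in> sets lebesgue" unfolding B_def by auto
  have Bfin: "emeasure lebesgue B < \<infinity>"
    by (rule order.strict_trans1[OF emeasure_mono emeasure_cell_finite[of n x]]) (auto simp: B_def)
  \<comment> \<open>A maximal cell inside \<open>U\<close> that meets \<open>B\<close> has average
    at most \<open>t\<close>, because no point of \<open>B\<close> sees a larger average at levels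
    up to \<open>n\<close>.\<close>
  have open_bound: "emeasure (density lebesgue g) B \<le> t * emeasure lebesgue U" if "open U" "B \<subseteq> U" for U
  proof -
    have cong: "(cell m z \<subseteq> U) = (cell m y \<subseteq> U)" if "z \<in> cell m y" for m y z
      using cell_eq[OF that] by simp
    obtain \<W> where \<W>: "countable \<W>" "disjoint \<W>" "\<W> \<subseteq> sets lebesgue"
      and U: "\<Union>\<W> = {y. \<exists>m\<le>n. cell m y \<subseteq> U}"
      and W: "\<forall>W\<in>\<W>. \<exists>m y. W = cell m y \<and> m \<le> n \<and> cell m y \<subseteq> U \<and> (\<forall>m'. m < m' \<and> m' \<le> n \<longrightarrow> \<not> cell m' y \<subseteq> U)"
      using maximal_cells[where P = "\<lambda>m y. cell m y \<subseteq> U", OF cong, of n] by blast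
    have "emeasure (density lebesgue g) (\<Union>\<W> \<inter> B) \<le> t * emeasure lebesgue (\<Union>\<W> \<inter> UNIV)"
    proof (rule emeasure_Union_comparison[OF \<W>(1,2)])
      fix V assume "V \<in> \<W>"
      then obtain m y where V: "V = cell m y" "m \<le> n" using W by blast
      show "emeasure (density lebesgue g) (V \<inter> B) \<le> t * emeasure lebesgue (V \<inter> UNIV)"
      proof (cases "V \<inter> B = {}")
        case False
        then obtain b where b: "b \<in> cell m y" "b \<in> B" using V by blast
        then have "eavg (cell m y) g \<le> t"
          using V(2) cell_eq[OF b(1)] unfolding B_def P_def by auto
        then have "emeasure (density lebesgue g) (cell m y) \<le> t * emeasure lebesgue (cell m y)"
          by (simp add: emeasure_density_cell mult_right_mono)
        moreover have "emeasure (density lebesgue g) (V \<inter> B) \<le> emeasure (density lebesgue g) (cell m y)"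
          using V by (intro emeasure_mono) auto
        ultimately show ?thesis using V by simp
      qed simp
    qed (use \<W> in auto)
    moreover have "B \<subseteq> \<Union>\<W>"
      unfolding U using cell_small[OF \<open>open U\<close>] \<open>B \<subseteq> U\<close> by blast
    then have "\<Union>\<W> \<inter> B = B" by blast
    moreover have "emeasure lebesgue (\<Union>\<W>) \<le> emeasure lebesgue U"
      using mem_cell \<open>open U\<close> unfolding U by (intro emeasure_mono) (auto intro: borel_open)
    ultimately show ?thesis
      by (metis inf_top_right mult_left_mono order_trans zero_le)
  qed
  have "emeasure (density lebesgue g) B \<le> t * emeasure lebesgue B"
  proof -
    show ?thesis
    proof (rule ennreal_le_epsilon)
      fix e :: real assume "e > 0"
      obtain l where l: "t = ennreal l" "l \<ge> 0" using \<open>t < \<infinity>\<close> by (cases t) auto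
      \<comment> \<open>Tolerance for outer regularity: multiplied by \<open>t\<close> it costs at
        most \<open>e\<close>, and adding 1 covers the case \<open>t = 0\<close>.\<close>
      have "e / (l + 1) > 0" using l \<open>e > 0\<close> by simp
      then obtain U where U: "open U" "B \<subseteq> U" "emeasure lebesgue (U - B) < ennreal (e / (l + 1))"
        using sets_lebesgue_outer_open[OF B] by metis
      have "emeasure lebesgue U = emeasure lebesgue B + emeasure lebesgue (U - B)"
        using U plus_emeasure[OF B, of "U - B"] sets.Diff[OF _ B, of U] by (auto simp: Un_absorb1 borel_open)
      then have "t * emeasure lebesgue U \<le> t * emeasure lebesgue B + ennreal l * ennreal (e / (l + 1))"
        using U(3) l by (auto simp: distrib_left intro!: add_left_mono mult_left_mono)
      also have "ennreal l * ennreal (e / (l + 1)) \<le> ennreal e"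
        using l \<open>e > 0\<close> by (simp add: ennreal_mult[symmetric] field_simps)
      finally show "emeasure (density lebesgue g) B \<le> t * emeasure lebesgue B + ennreal e"
        using open_bound[OF U(1,2)] by (meson add_left_mono order_trans)
    qed 
  qed
  then have le: "(\<integral>\<^sup>+ y. g y * indicator B y \<partial>lebesgue) \<le> (\<integral>\<^sup>+ y. t * indicator B y \<partial>lebesgue)"
    by (simp add: emeasure_density nn_integral_cmult)
  have "AE y in lebesgue. g y * indicator B y \<le> t * indicator B y"
  proof (rule ccontr)
    assume "\<not> ?thesis"
    then have "(\<integral>\<^sup>+ y. t * indicator B y \<partial>lebesgue) < (\<integral>\<^sup>+ y. g y * indicator B y \<partial>lebesgue)"
      using assms(2) Bfin
      by (intro nn_integral_less)
        (simp_all add: nn_integral_cmult ennreal_mult_eq_top_iff, auto simp: B_def indicator_def intro!: AE_I2)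
    with le show False by simp
  qed
  then show ?thesis
  proof eventually_elim
    case (elim y)
    show ?case
    proof (intro impI, rule ccontr)
      assume *: "y \<in> cell n x" "\<forall>m\<le>n. eavg (cell m y) g \<le> t" "\<not> g y \<le> t"
      then have "y \<in> B" by (auto simp: B_def P_def not_le not_less)
      with elim * show False by simp
    qed
  qed
qed

end

section \<open>The reverse Hoelder inequality for A1 weights\<close>

context dyadic_grid
begin

text \<open>A topmost cell for \<open>s\<close> has average at most \<open>2 ^ DIM('a) * s\<close>,
  since its parent does not exceed \<open>s\<close>. The extra factor 2 in \<open>s'\<close> makes
  the weak-type estimate leave at least half of the cell outside the set for \<open>s'\<close>, and
  on that half the A1 condition bounds the average by \<open>L * w\<close>.\<close>

lemma A1_level_decay:
  assumes w[measurable]: "w \<in> borel_measurable lebesgue"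
    and A1: "\<And>m y. m \<le> n \<Longrightarrow> eavg (cell m y) w \<le> ennreal L * w y" and "L > 0"
    and s: "s > 0" "eavg (cell n x) w \<le> ennreal s"
    and s': "s' = 2 ^ (DIM('a) + 1) * s"
  shows "emeasure (density lebesgue w) (cell n x \<inter> {y. \<exists>m\<le>n. ennreal s < eavg (cell m y) w})
    \<le> ennreal (2 * L) * emeasure (density lebesgue w)
      ((cell n x \<inter> {y. \<exists>m\<le>n. ennreal s < eavg (cell m y) w}) -
       (cell n x \<inter> {y. \<exists>m\<le>n. ennreal s' < eavg (cell m y) w}))"
proof -
  define P where "P r m y \<longleftrightarrow> ennreal r < eavg (cell m y) w" for r m y
  have cong: "P r m z = P r m y" if "z \<in> cell m y" for r m y z
    using that by (simp add: P_def eavg_cell_cong)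
  define \<Omega> where "\<Omega> r = cell n x \<inter> {y. \<exists>m\<le>n. P r m y}" for r
  have \<Omega>[measurable]: "\<Omega> r \<in> sets lebesgue" for r
    unfolding \<Omega>_def by (intro sets.Int sets_cell sets_stopped[OF cong])
  have "s < s'" using s one_less_power[of "2::real" "DIM('a) + 1"] unfolding s' by simp
  let ?\<nu> = "density lebesgue w"
  obtain \<W> where \<W>: "countable \<W>" "disjoint \<W>" "\<W> \<subseteq> sets lebesgue"
    and U: "\<Union>\<W> = {y. \<exists>m\<le>n. P s m y}"
    and W: "\<forall>W\<in>\<W>. \<exists>m y. W = cell m y \<and> m \<le> n \<and> P s m y \<and> (\<forall>m'. m < m' \<and> m' \<le> n \<longrightarrow> \<not> P s m' y)"
    by (rule maximal_cells[where P = "P s" and n = n, OF cong]) blast+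
  have "emeasure ?\<nu> (\<Union>\<W> \<inter> cell n x) \<le> ennreal (2 * L) * emeasure ?\<nu> (\<Union>\<W> \<inter> (cell n x - \<Omega> s'))"
  proof (rule emeasure_Union_comparison[OF \<W>(1,2)])
    fix V assume "V \<in> \<W>"
    then obtain m y where V: "V = cell m y" "m \<le> n" "P s m y"
      and Vmax: "\<And>m'. m < m' \<Longrightarrow> m' \<le> n \<Longrightarrow> \<not> P s m' y" using bspec[OF W] by metis
    show "emeasure ?\<nu> (V \<inter> cell n x) \<le> ennreal (2 * L) * emeasure ?\<nu> (V \<inter> (cell n x - \<Omega> s'))"
    proof (cases "V \<inter> cell n x = {}")
      case False
      then obtain z where z: "z \<in> cell m y" "z \<in> cell n x" using V by blast
      then have sub: "cell m y \<subseteq> cell n x"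
        using cell_eq[OF z(1)] cell_eq[OF z(2)] cell_mono[OF V(2), of z] by simp
      then have eqs: "V \<inter> cell n x = cell m y" "V \<inter> (cell n x - \<Omega> s') = cell m y - \<Omega> s'"
        using V by blast+
      \<comment> \<open>\<open>cell n x\<close> itself has average at most \<open>s\<close>, so a
        selected cell is strictly smaller and its parent is still within the cap.\<close>
      have "m \<noteq> n"
      proof
        assume "m = n"
        then have "cell m y = cell n x" using z cell_eq by metis
        with V(3) s(2) show False by (simp add: P_def)
      qed
      then have mn: "m + 1 \<le> n" using V(2) by simp
      let ?\<alpha> = "eavg (cell m y) w"
      have "?\<alpha> \<le> 2 ^ DIM('a) * eavg (cell (m + 1) y) w" by (rule eavg_cell_Suc)
      also have "\<dots> \<le> 2 ^ DIM('a) * ennreal s"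
        using Vmax[of "m + 1"] mn by (intro mult_left_mono) (auto simp: P_def not_less)
      also have "\<dots> = ennreal (2 ^ DIM('a) * s)"
        using s by (simp add: ennreal_mult flip: ennreal_power)
      finally have \<alpha>: "?\<alpha> \<le> ennreal (2 ^ DIM('a) * s)" .
      have vfin: "emeasure lebesgue (cell m y) < top" using emeasure_cell_finite by simp
      have pfin: "emeasure lebesgue (cell m y \<inter> \<Omega> s') < top"
        by (rule order.strict_trans1[OF emeasure_mono vfin]) auto
      obtain p where p: "emeasure lebesgue (cell m y \<inter> \<Omega> s') = ennreal p" "p \<ge> 0"
        using pfin by (cases "emeasure lebesgue (cell m y \<inter> \<Omega> s')") auto
      obtain v where v: "emeasure lebesgue (cell m y) = ennreal v" "v \<ge> 0"
        using vfin by (cases "emeasure lebesgue (cell m y)") auto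
      \<comment> \<open>Above level \<open>m\<close> no average exceeds \<open>s\<close>, let alone
        \<open>s'\<close>; so these points are detected inside the cell, where the local weak-type
        estimate applies.\<close>
      have "cell m y \<inter> \<Omega> s' \<subseteq> cell m y \<inter> {z. \<exists>m'\<le>m. ennreal s' \<le> eavg (cell m' z) w}"
      proof (intro subsetI IntI CollectI)
        fix z assume z: "z \<in> cell m y \<inter> \<Omega> s'"
        then obtain m' where m': "m' \<le> n" "P s' m' z" by (auto simp: \<Omega>_def)
        have "m' \<le> m"
        proof (rule ccontr)
          assume "\<not> m' \<le> m"
          then have "\<not> P s m' y" and "cell m' z = cell m' y"
            using Vmax m' z cell_eq_le[of z m y m'] by auto
          then have "ennreal s' < ennreal s"
            using m'(2) by (simp add: P_def)
          then show False using \<open>s < s'\<close> s by (simp add: ennreal_less_iff)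
        qed
        then show "\<exists>m'\<le>m. ennreal s' \<le> eavg (cell m' z) w" using m' by (auto simp: P_def)
      qed auto
      then have "ennreal s' * ennreal p
          \<le> ennreal s' * emeasure lebesgue (cell m y \<inter> {z. \<exists>m'\<le>m. ennreal s' \<le> eavg (cell m' z) w})"
        unfolding p(1)[symmetric]
        by (intro mult_left_mono emeasure_mono sets.Int sets_cell sets_stopped) (auto simp: eavg_cell_cong)
      also have "\<dots> \<le> (\<integral>\<^sup>+ y\<in>cell m y. w y \<partial>lebesgue)"
        by (rule dyadic_weak_type[OF w])
      also have "\<dots> = ?\<alpha> * emeasure lebesgue (cell m y)"
        by (simp add: eavg_mult_emeasure)
      also have "\<dots> \<le> ennreal (2 ^ DIM('a) * s) * ennreal v"
        unfolding v using \<alpha> by (intro mult_right_mono) auto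
      finally have "s' * p \<le> 2 ^ DIM('a) * s * v"
        using s p v \<open>s < s'\<close> by (simp flip: ennreal_mult)
      then have pv: "2 * p \<le> v" using s by (simp add: s')
      have "emeasure lebesgue (cell m y - \<Omega> s') = emeasure lebesgue (cell m y) - emeasure lebesgue (cell m y \<inter> \<Omega> s')"
        using emeasure_Diff[of lebesgue "cell m y \<inter> \<Omega> s'" "cell m y"] pfin by (simp add: Diff_Int)
      then have "emeasure lebesgue (cell m y - \<Omega> s') = ennreal (v - p)"
        using p v by (simp add: ennreal_minus)
      then have half: "emeasure lebesgue (cell m y) \<le> 2 * emeasure lebesgue (cell m y - \<Omega> s')"
        using pv p v by (simp add: ennreal_leI flip: ennreal_numeral ennreal_mult)
      have "emeasure ?\<nu> (cell m y) = ?\<alpha> * emeasure lebesgue (cell m y)"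
        by (simp add: emeasure_density_cell)
      also have "\<dots> \<le> ?\<alpha> * (2 * emeasure lebesgue (cell m y - \<Omega> s'))"
        using half by (rule mult_left_mono) simp
      also have "\<dots> = 2 * (\<integral>\<^sup>+ z\<in>cell m y - \<Omega> s'. ?\<alpha> \<partial>lebesgue)"
        by (simp add: nn_integral_cmult ac_simps)
      also have "\<dots> \<le> 2 * (\<integral>\<^sup>+ z\<in>cell m y - \<Omega> s'. ennreal L * w z \<partial>lebesgue)"
      proof (intro mult_left_mono nn_integral_mono)
        fix z
        show "?\<alpha> * indicator (cell m y - \<Omega> s') z \<le> ennreal L * w z * indicator (cell m y - \<Omega> s') z"
          using A1[OF V(2), of z] by (auto simp: indicator_def cell_eq)
      qed simp
      also have "\<dots> = ennreal (2 * L) * emeasure ?\<nu> (cell m y - \<Omega> s')"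
        using \<open>L > 0\<close> by (simp add: emeasure_density nn_integral_cmult ennreal_mult mult.assoc)
      finally show ?thesis unfolding eqs .
    qed simp
  qed (use \<W> in auto)
  moreover have "\<Union>\<W> \<inter> cell n x = \<Omega> s" "\<Union>\<W> \<inter> (cell n x - \<Omega> s') = \<Omega> s - \<Omega> s'"
    unfolding U \<Omega>_def by blast+
  ultimately show ?thesis unfolding \<Omega>_def P_def by simp
qed

text \<open>A layer-cake sum over the levels \<open>l0 * a ^ k\<close>: the \<open>w\<close>-mass of
  the level sets decays by \<open>\<theta>\<close> per level while \<open>w powr \<delta>\<close>
  grows by \<open>q\<close>. The second assumption on \<open>\<delta>\<close> reads
  \<open>q * (1 + \<theta>) \<le> 2\<close>, which makes the level sum no larger than the
  \<open>w\<close>-mass \<open>N\<close> of the whole cell; the constant 2 is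
  \<open>N + N\<close>.\<close>

lemma reverse_holder:
  assumes w[measurable]: "w \<in> borel_measurable lebesgue"
    and w_fin: "AE y in lebesgue. w y < \<infinity>"
    and A1: "\<And>m y. m \<le> n \<Longrightarrow> eavg (cell m y) w \<le> ennreal L * w y" and L: "L \<ge> 1"
    and fin: "eavg (cell n x) w < \<infinity>"
    and \<delta>: "\<delta> > 0" "(2 ^ (DIM('a) + 1)) powr \<delta> * (2 - 1 / (2 * L)) \<le> 2"
  shows "eavg (cell n x) (\<lambda>y. ennreal (enn2real (w y) powr (1 + \<delta>)))
    \<le> ennreal (2 * enn2real (eavg (cell n x) w) powr (1 + \<delta>))"
proof -
  define l0 where "l0 = enn2real (eavg (cell n x) w)"
  have l0: "eavg (cell n x) w = ennreal l0" "l0 \<ge> 0" using fin by (auto simp: l0_def)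
  define a :: real where "a = 2 ^ (DIM('a) + 1)"
  have a: "a > 1" unfolding a_def by (rule one_less_power) auto
  define q where "q = a powr \<delta>"
  have q: "q > 1" unfolding q_def using a \<delta> by simp
  \<comment> \<open>Solves \<open>t k \<le> 2 * L * (t k - t (Suc k))\<close> for the ratio of
    consecutive masses.\<close>
  define \<theta> where "\<theta> = 1 - 1 / (2 * L)"
  have \<theta>: "0 \<le> \<theta>" "\<theta> < 1" using L by (auto simp: \<theta>_def field_simps)
  have q\<theta>: "q * (1 + \<theta>) \<le> 2" using \<delta>(2) by (simp add: q_def a_def \<theta>_def)
  have q\<theta>1: "q * \<theta> < 1"
  proof -
    have "q * (1 + \<theta>) = q + q * \<theta>" by (simp add: algebra_simps)
    then show ?thesis using q\<theta> q by simp
  qed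
  let ?\<nu> = "density lebesgue w" and ?C = "cell n x"
  define N where "N = l0 * side n ^ DIM('a)"
  have N: "emeasure ?\<nu> ?C = ennreal N" "N \<ge> 0"
    using l0 side_pos[of n] by (auto simp: emeasure_density_cell emeasure_cell N_def ennreal_mult less_imp_le)
  show ?thesis
  \<comment> \<open>The geometric levels collapse when the average is 0, but then \<open>w\<close>
    vanishes almost everywhere on the cell.\<close>
  proof (cases "l0 = 0")
    case True
    then have "(\<integral>\<^sup>+ y\<in>?C. w y \<partial>lebesgue) = 0"
      using N by (simp add: emeasure_density N_def)
    then have "AE y in lebesgue. w y * indicator ?C y = 0"
      by (subst (asm) nn_integral_0_iff_AE) auto
    then have "AE y in lebesgue. ennreal (enn2real (w y) powr (1 + \<delta>)) * indicator ?C y = 0"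
      by eventually_elim (auto simp: indicator_def)
    then have "(\<integral>\<^sup>+ y\<in>?C. ennreal (enn2real (w y) powr (1 + \<delta>)) \<partial>lebesgue) = 0"
      by (subst nn_integral_0_iff_AE) auto
    then show ?thesis by (simp add: eavg_def)
  next
    case False
    then have l0_pos: "l0 > 0" using l0 by simp
    define lam where "lam k = l0 * a ^ k" for k
    have lam: "lam k \<ge> l0" "lam k > 0" for k
      using l0_pos a one_le_power[of a k] by (auto simp: lam_def)
    define \<Omega> where "\<Omega> k = ?C \<inter> {y. \<exists>m\<le>n. ennreal (lam k) < eavg (cell m y) w}" for k
    have \<Omega>[measurable]: "\<Omega> k \<in> sets lebesgue" for k
      unfolding \<Omega>_def by (intro sets.Int sets_cell sets_stopped) (auto simp: eavg_cell_cong)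
    have \<Omega>_decr: "\<Omega> (Suc k) \<subseteq> \<Omega> k" for k
    proof -
      have "lam k \<le> lam (Suc k)" using l0_pos a by (simp add: lam_def)
      then show ?thesis unfolding \<Omega>_def by (auto intro: order.strict_trans1[OF ennreal_leI])
    qed
    define t where "t k = enn2real (emeasure ?\<nu> (\<Omega> k))" for k
    have \<Omega>_le: "emeasure ?\<nu> (\<Omega> k) \<le> ennreal N" for k
      unfolding N(1)[symmetric] by (intro emeasure_mono) (auto simp: \<Omega>_def)
    then have \<Omega>_fin: "emeasure ?\<nu> (\<Omega> k) < top" for k
      using order.strict_trans1 ennreal_less_top by blast
    then have t: "emeasure ?\<nu> (\<Omega> k) = ennreal (t k)" "t k \<ge> 0" for k
      by (simp_all add: t_def)
    have decay: "t (Suc k) \<le> \<theta> * t k" for k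
    proof -
      have "emeasure ?\<nu> (\<Omega> k) \<le> ennreal (2 * L) * emeasure ?\<nu> (\<Omega> k - \<Omega> (Suc k))"
        unfolding \<Omega>_def
        by (rule A1_level_decay[OF w A1])
          (use L lam[of k] l0 in \<open>auto simp: lam_def a_def intro: ennreal_leI\<close>)
      also have "emeasure ?\<nu> (\<Omega> k - \<Omega> (Suc k)) = ennreal (t k - t (Suc k))"
        using \<Omega>_fin \<Omega>_decr by (subst emeasure_Diff) (auto simp: t ennreal_minus)
      finally have "ennreal (t k) \<le> ennreal (2 * L) * ennreal (t k - t (Suc k))"
        by (simp add: t)
      moreover have "t (Suc k) \<le> t k"
        using emeasure_mono[OF \<Omega>_decr[of k], of ?\<nu>] by (simp add: t)
      ultimately have "t k \<le> 2 * L * (t k - t (Suc k))"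
        using L by (simp flip: ennreal_mult)
      then show ?thesis using L by (simp add: \<theta>_def field_simps)
    qed
    have t_le: "t k \<le> \<theta> ^ k * N" for k
    proof (induction k)
      case 0
      show ?case using \<Omega>_le[of 0] N by (simp add: t)
    next
      case (Suc k)
      have "t (Suc k) \<le> \<theta> * (\<theta> ^ k * N)"
        using decay[of k] mult_left_mono[OF Suc \<theta>(1)] by simp
      then show ?case by simp
    qed
    have AE_le: "AE y in lebesgue. \<forall>k. y \<in> ?C \<longrightarrow> y \<notin> \<Omega> k \<longrightarrow> w y \<le> ennreal (lam k)"
      unfolding AE_all_countable
    proof
      fix k
      show "AE y in lebesgue. y \<in> ?C \<longrightarrow> y \<notin> \<Omega> k \<longrightarrow> w y \<le> ennreal (lam k)"
        using AE_le_of_averages_le[OF w, of "ennreal (lam k)" n x, simplified]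
        by eventually_elim (auto simp: \<Omega>_def not_less)
    qed
    \<comment> \<open>Telescoping: \<open>H y\<close> equals \<open>q ^ K\<close> at a point of the
      cell that lies in exactly the first \<open>K\<close> level sets.\<close>
    define H where "H y = (indicator ?C y + (\<Sum>j. ennreal ((q - 1) * q ^ j) * indicator (\<Omega> j) y))" for y
    have [measurable]: "H \<in> borel_measurable lebesgue" unfolding H_def by measurable
    have bound: "AE y in lebesgue. ennreal (enn2real (w y) powr (1 + \<delta>)) * indicator ?C y
        \<le> ennreal (l0 powr \<delta>) * (w y * H y)"
      using AE_le w_fin
    proof eventually_elim
      case (elim y)
      show ?case
      proof (cases "y \<in> ?C")
        case True
        define v where "v = enn2real (w y)"
        have v: "w y = ennreal v" "v \<ge> 0" using elim(2) by (simp_all add: v_def)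
        obtain k0 where k0: "v / l0 < a ^ k0" using real_arch_pow[OF a] by blast
        \<comment> \<open>The first level reaching \<open>v\<close>. All earlier level sets contain
          \<open>y\<close>, because off \<open>\<Omega> j\<close> almost everywhere
          \<open>w y \<le> lam j\<close>.\<close>
        define K where "K = (LEAST k. v \<le> lam k)"
        have vK: "v \<le> lam K"
          unfolding K_def by (rule LeastI[of _ k0]) (use k0 l0_pos in \<open>simp add: lam_def field_simps\<close>)
        have in\<Omega>: "y \<in> \<Omega> j" if "j < K" for j
        proof (rule ccontr)
          assume "y \<notin> \<Omega> j"
          then have "v \<le> lam j" using elim(1) True v lam[of j] by (auto simp: less_imp_le)
          then show False using that not_less_Least unfolding K_def by blast
        qed
        have "v powr \<delta> \<le> lam K powr \<delta>" using vK v \<delta> by (intro powr_mono2) auto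
        also have "\<dots> = l0 powr \<delta> * q ^ K"
          using l0_pos a by (simp add: lam_def powr_mult q_def powr_powr flip: powr_realpow) (simp add: mult.commute)
        also have "q ^ K = 1 + (\<Sum>j<K. (q - 1) * q ^ j)"
          using power_diff_1_eq[of q K] by (simp flip: sum_distrib_left)
        finally have "ennreal (v powr \<delta>) \<le> ennreal (l0 powr \<delta> * (1 + (\<Sum>j<K. (q - 1) * q ^ j)))"
          by (rule ennreal_leI)
        also have "\<dots> = ennreal (l0 powr \<delta>) * (1 + (\<Sum>j<K. ennreal ((q - 1) * q ^ j)))"
          using q by (subst sum_ennreal) (simp_all add: ennreal_mult sum_nonneg)
        also have "\<dots> \<le> ennreal (l0 powr \<delta>) * H y"
        proof (intro mult_left_mono)
          have "(\<Sum>j<K. ennreal ((q - 1) * q ^ j)) = (\<Sum>j<K. ennreal ((q - 1) * q ^ j) * indicator (\<Omega> j) y)"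
            by (intro sum.cong) (auto simp: in\<Omega>)
          also have "\<dots> \<le> (\<Sum>j. ennreal ((q - 1) * q ^ j) * indicator (\<Omega> j) y)"
            by (intro sum_le_suminf) auto
          finally show "1 + (\<Sum>j<K. ennreal ((q - 1) * q ^ j)) \<le> H y"
            using True by (simp add: H_def add_left_mono)
        qed simp
        finally have "ennreal (v powr \<delta>) \<le> ennreal (l0 powr \<delta>) * H y" .
        then have "w y * ennreal (v powr \<delta>) \<le> w y * (ennreal (l0 powr \<delta>) * H y)"
          by (rule mult_left_mono) simp
        moreover have "w y * ennreal (v powr \<delta>) = ennreal (v powr (1 + \<delta>))"
          unfolding v(1) using v(2) by (cases "v = 0") (auto simp: powr_add simp flip: ennreal_mult)
        ultimately show ?thesis using True by (simp add: v_def ac_simps)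
      qed simp
    qed
    have "(\<Sum>j. ennreal ((q - 1) * q ^ j) * emeasure ?\<nu> (\<Omega> j)) \<le> (\<Sum>j. ennreal ((q - 1) * N * (q * \<theta>) ^ j))"
    proof (intro suminf_le)
      fix j
      have "(q - 1) * q ^ j * t j \<le> (q - 1) * q ^ j * (\<theta> ^ j * N)"
        using q t_le by (intro mult_left_mono) auto
      then have "ennreal ((q - 1) * q ^ j * t j) \<le> ennreal ((q - 1) * N * (q * \<theta>) ^ j)"
        by (intro ennreal_leI) (simp add: power_mult_distrib ac_simps)
      then show "ennreal ((q - 1) * q ^ j) * emeasure ?\<nu> (\<Omega> j) \<le> ennreal ((q - 1) * N * (q * \<theta>) ^ j)"
        using q t[of j] by (subst (asm) ennreal_mult) auto
    qed auto
    also have "\<dots> = ennreal ((q - 1) * N * (1 / (1 - q * \<theta>)))"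
      using q \<theta> q\<theta>1 N by (intro suminf_ennreal_eq sums_mult geometric_sums) auto
    also have "\<dots> \<le> ennreal N"
    proof (rule ennreal_leI)
      \<comment> \<open>This is the smallness of \<open>\<delta>\<close>; it absorbs the denominator
        of the geometric series.\<close>
      have "(q - 1) \<le> 1 - q * \<theta>" using q\<theta> by (simp add: algebra_simps)
      then have "(q - 1) * (1 / (1 - q * \<theta>)) \<le> 1" using q\<theta>1 by (simp add: field_simps)
      then have "(q - 1) * (1 / (1 - q * \<theta>)) * N \<le> 1 * N" using N by (intro mult_right_mono) auto
      then show "(q - 1) * N * (1 / (1 - q * \<theta>)) \<le> N" by (simp add: ac_simps)
    qed
    finally have sum_le: "(\<Sum>j. ennreal ((q - 1) * q ^ j) * emeasure ?\<nu> (\<Omega> j)) \<le> ennreal N" .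
    have "(\<integral>\<^sup>+ y. H y \<partial>?\<nu>) = emeasure ?\<nu> ?C + (\<Sum>j. ennreal ((q - 1) * q ^ j) * emeasure ?\<nu> (\<Omega> j))"
      unfolding H_def by (simp add: nn_integral_add nn_integral_suminf nn_integral_cmult)
    also have "\<dots> \<le> ennreal N + ennreal N"
      unfolding N(1) using sum_le by (rule add_left_mono)
    also have "\<dots> = ennreal (2 * N)" using N by (simp flip: ennreal_plus)
    finally have H_le: "(\<integral>\<^sup>+ y. H y \<partial>?\<nu>) \<le> ennreal (2 * N)" .
    have "(\<integral>\<^sup>+ y\<in>?C. ennreal (enn2real (w y) powr (1 + \<delta>)) \<partial>lebesgue)
        \<le> (\<integral>\<^sup>+ y. ennreal (l0 powr \<delta>) * (w y * H y) \<partial>lebesgue)"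
      by (rule nn_integral_mono_AE[OF bound])
    also have "\<dots> = ennreal (l0 powr \<delta>) * (\<integral>\<^sup>+ y. H y \<partial>?\<nu>)"
      by (simp add: nn_integral_cmult nn_integral_density)
    also have "\<dots> \<le> ennreal (l0 powr \<delta>) * ennreal (2 * N)"
      using H_le by (rule mult_left_mono) simp
    finally have "(\<integral>\<^sup>+ y\<in>?C. ennreal (enn2real (w y) powr (1 + \<delta>)) \<partial>lebesgue) \<le> ennreal (l0 powr \<delta>) * ennreal (2 * N)" .
    then have "eavg ?C (\<lambda>y. ennreal (enn2real (w y) powr (1 + \<delta>))) \<le> ennreal (l0 powr \<delta>) * ennreal (2 * N) / ennreal (side n ^ DIM('a))"
      unfolding eavg_def emeasure_cell by (rule divide_right_mono_ennreal)
    also have "\<dots> = ennreal (l0 powr \<delta> * (2 * N) / side n ^ DIM('a))"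
      using N side_pos[of n] by (simp add: divide_ennreal flip: ennreal_mult)
    also have "l0 powr \<delta> * (2 * N) / side n ^ DIM('a) = 2 * l0 powr (1 + \<delta>)"
      using l0_pos side_pos[of n] by (simp add: N_def powr_add)
    finally show ?thesis by (simp add: l0_def)
  qed
qed

end

section \<open>Sparse operators and record cubes\<close>

definition esparse :: "'a::euclidean_space set set \<Rightarrow> ('a \<Rightarrow> ennreal) \<Rightarrow> 'a \<Rightarrow> ennreal" where
  "esparse S g x = (\<integral>\<^sup>+ Q. eavg Q g * indicator Q x \<partial>count_space S)"

lemma sparse_op_eq_esparse: "sparse_op S f = esparse S (\<lambda>y. ennreal \<bar>f y\<bar>)"
  by (simp add: fun_eq_iff sparse_op_def esparse_def avg_def eavg_def)

lemma cubes_sets: "Q \<in> cubes \<Longrightarrow> Q \<in> sets lebesgue"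
  by (auto simp: cubes_def)

lemma cubes_bounded: "Q \<in> cubes \<Longrightarrow> bounded Q"
  by (auto simp: cubes_def bounded_cbox)

lemma cubes_measure_pos: "Q \<in> cubes \<Longrightarrow> measure lebesgue Q > 0"
  by (auto simp: cubes_def content_cbox_if inner_add_left box_eq_empty intro!: prod_pos)

text \<open>Inside a fixed ball only finitely many disjoint sets \<open>E Q\<close> can have measure
  above a given positive bound. Countability makes \<open>count_space S\<close> sigma-finite, which
  the measurability of \<open>esparse\<close> relies on.\<close>

lemma sparse_countable:
  fixes S :: "'a::euclidean_space set set"
  assumes "sparse S"
  shows "countable S"
proof -
  from assms obtain E where S: "S \<subseteq> cubes"
    and E: "\<And>Q. Q \<in> S \<Longrightarrow> E Q \<in> sets lebesgue \<and> E Q \<subseteq> Q \<and> measure lebesgue (E Q) \<ge> 1/2 * measure lebesgue Q"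
    and disj: "\<And>Q Q'. Q \<in> S \<Longrightarrow> Q' \<in> S \<Longrightarrow> Q \<noteq> Q' \<Longrightarrow> E Q \<inter> E Q' = {}"
    unfolding sparse_def by metis
  define B where "B n = (cball 0 (real n) :: 'a set)" for n
  define F where "F n = {Q \<in> S. Q \<subseteq> B n \<and> 1 / (real n + 1) \<le> measure lebesgue (E Q)}" for n
  have "finite (F n)" for n
  proof -
    have "card G \<le> nat \<lfloor>(real n + 1) * measure lebesgue (B n)\<rfloor>" if G: "G \<subseteq> F n" "finite G" for G
    proof -
      have "real (card G) * (1 / (real n + 1)) = (\<Sum>Q\<in>G. 1 / (real n + 1))" by simp
      also have "\<dots> \<le> (\<Sum>Q\<in>G. measure lebesgue (E Q))"
        using G by (intro sum_mono) (auto simp: F_def)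
      also have "\<dots> = measure lebesgue (\<Union>Q\<in>G. E Q)"
      proof (rule measure_finite_Union[symmetric])
        show "disjoint_family_on E G"
          unfolding disjoint_family_on_def
        proof (intro ballI impI)
          fix Q Q' assume "Q \<in> G" "Q' \<in> G" "Q \<noteq> Q'"
          then show "E Q \<inter> E Q' = {}" using G disj[of Q Q'] unfolding F_def by blast
        qed
        show "emeasure lebesgue (E Q) \<noteq> \<infinity>" if "Q \<in> G" for Q
        proof -
          have "E Q \<subseteq> B n" "E Q \<in> sets lebesgue" using that G E by (auto simp: F_def)
          then have "E Q \<in> lmeasurable"
            by (intro bounded_set_imp_lmeasurable) (auto simp: B_def intro: bounded_subset[OF bounded_cball])
          then show ?thesis by (simp add: fmeasurableD2)
        qed
      qed (use G E in \<open>auto simp: F_def\<close>)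
      also have "\<dots> \<le> measure lebesgue (B n)"
        using G E by (intro measure_mono_fmeasurable) (auto simp: F_def B_def)
      finally have "real (card G) \<le> (real n + 1) * measure lebesgue (B n)" by (simp add: field_simps)
      then show ?thesis by (rule le_nat_floor)
    qed
    then show ?thesis using finite_if_finite_subsets_card_bdd[of "F n"] by blast
  qed
  moreover have "S = (\<Union>n. F n)"
  proof (intro equalityI subsetI)
    fix Q assume Q: "Q \<in> S"
    obtain r where r: "\<And>x. x \<in> Q \<Longrightarrow> norm x \<le> r"
      using Q S cubes_bounded unfolding bounded_iff by blast
    have pos: "measure lebesgue (E Q) > 0" using E[OF Q] cubes_measure_pos S Q by fastforce
    obtain n :: nat where n: "n \<ge> max r (1 / measure lebesgue (E Q))" using real_arch_simple by blast
    have "1 / measure lebesgue (E Q) \<le> real n + 1" using n by simp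
    then have "1 / (real n + 1) \<le> measure lebesgue (E Q)" using pos by (simp add: field_simps)
    moreover have "Q \<subseteq> B n" using r n by (force simp: B_def)
    ultimately show "Q \<in> (\<Union>n. F n)" using Q by (auto simp: F_def)
  qed (auto simp: F_def)
  ultimately show ?thesis by (auto intro: countable_finite)
qed

lemma borel_measurable_esparse:
  assumes "sparse S"
  shows "esparse S g \<in> borel_measurable lebesgue"
proof -
  have c: "countable S" by (rule sparse_countable[OF assms])
  interpret sigma_finite_measure "count_space S" using c by (rule sigma_finite_measure_count_space_countable)
  have "(\<lambda>z. eavg (snd z) g * indicator (snd z) (fst z)) \<in> borel_measurable (lebesgue \<Otimes>\<^sub>M count_space S)"
  proof (rule measurable_compose_countable'[OF _ measurable_snd c])
    fix Q assume "Q \<in> S"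
    then have [measurable]: "Q \<in> sets lebesgue" using assms cubes_sets by (auto simp: sparse_def)
    have "(\<lambda>x. eavg Q g * indicator Q x) \<in> borel_measurable lebesgue" by measurable
    then show "(\<lambda>z. eavg Q g * indicator Q (fst z)) \<in> borel_measurable (lebesgue \<Otimes>\<^sub>M count_space S)"
      by (rule measurable_compose[OF measurable_fst])
  qed
  then have "(\<lambda>(x, Q). eavg Q g * indicator Q x) \<in> borel_measurable (lebesgue \<Otimes>\<^sub>M count_space S)"
    by (simp add: case_prod_beta')
  from borel_measurable_nn_integral[OF this] show ?thesis by (simp add: esparse_def[abs_def])
qed

lemma esparse_ge_single: "Q \<in> S \<Longrightarrow> x \<in> Q \<Longrightarrow> eavg Q g \<le> esparse S g x"
  unfolding esparse_def using nn_integral_ge_point[of Q S "\<lambda>Q. eavg Q g * indicator Q x"] by simp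

lemma powr_int_bracket:
  fixes b \<alpha> :: real
  assumes "b > 1" "\<alpha> > 0"
  shows "\<exists>k::int. b powr k < \<alpha> \<and> \<alpha> \<le> b * b powr k"
proof -
  \<comment> \<open>Ceiling minus one rather than floor: the lower inequality must be strict, since
    record levels are defined by strict excess.\<close>
  define k where "k = \<lceil>log b \<alpha>\<rceil> - 1"
  have k: "of_int k < log b \<alpha>" "log b \<alpha> \<le> of_int k + 1" unfolding k_def by linarith+
  have "b powr k < \<alpha>" using k(1) assms by (simp add: powr_less_iff)
  moreover have "\<alpha> \<le> b powr (of_int k + 1)" using k(2) assms by (simp add: le_powr_iff)
  ultimately show ?thesis using assms by (auto simp: powr_add ac_simps)
qed

lemma powr_int_Suc: "b > 0 \<Longrightarrow> b powr (of_int (k + 1)) = b * b powr (of_int k :: real)"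
  by (simp add: powr_add)

section \<open>Towers of nested cubes and consequences of finite sparse operators\<close>

context dyadic_grid
begin

lemma side_inj: "side n = side m \<Longrightarrow> n = m"
proof (induction n m rule: linorder_wlog)
  case (le n m)
  have "side n = side (m - int (nat (m - n)))" using le(1) by simp
  also have "\<dots> = side m / 2 ^ nat (m - n)" by (rule side_diff)
  finally have "2 ^ nat (m - n) = (1::real)" using le(2) side_pos[of m] by (simp add: field_simps)
  then have "(2::real) ^ nat (m - n) = 2 ^ 0" by simp
  then have "nat (m - n) = 0" by (subst (asm) power_inject_exp) simp_all
  then show ?case using le(1) by simp
qed auto

text \<open>Ensures that infinitely many levels of a tower give infinitely many members of the
  family.\<close>

lemma cube_level_inj: "cube n x = cube m x \<Longrightarrow> n = m"
proof -
  assume "cube n x = cube m x"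
  then have "side n ^ DIM('a) = side m ^ DIM('a)"
    using emeasure_cube[of n x] emeasure_cube[of m x] side_pos[of n] side_pos[of m]
    by (simp add: less_imp_le)
  then have "side n = side m"
    using side_pos[of n] side_pos[of m] by (simp add: power_eq_iff_eq_base)
  then show ?thesis by (rule side_inj)
qed

lemma measure_cell: "measure lebesgue (cell n x) = side n ^ DIM('a)"
  and measure_cube: "measure lebesgue (cube n x) = side n ^ DIM('a)"
  using side_pos[of n] by (simp_all add: measure_def emeasure_cell emeasure_cube less_imp_le)

lemma lmeasurable_cell: "cell n x \<in> lmeasurable"
  using emeasure_cell_finite[of n x] by (intro fmeasurableI) auto

text \<open>Removing from each cell its child around \<open>x\<close> makes the pieces disjoint and
  costs only the fraction \<open>1 / 2 ^ DIM('a)\<close>, at most one half.\<close>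

lemma sparse_tower: "sparse ((\<lambda>n. cube n x) ` I)"
  unfolding sparse_def
proof (intro conjI exI ballI impI)
  define lev where "lev Q = (SOME n. n \<in> I \<and> Q = cube n x)" for Q
  have lev: "lev Q \<in> I \<and> Q = cube (lev Q) x" if "Q \<in> (\<lambda>n. cube n x) ` I" for Q
    unfolding lev_def by (rule someI_ex) (use that in blast)
  define E where "E Q = cell (lev Q) x - cell (lev Q - 1) x" for Q
  show "(\<lambda>n. cube n x) ` I \<subseteq> cubes" using cube_in_cubes by blast
  fix Q assume Q: "Q \<in> (\<lambda>n. cube n x) ` I"
  define n where "n = lev Q"
  have Qn: "Q = cube n x" using lev[OF Q] by (simp add: n_def)
  have EQ: "E Q = cell n x - cell (n - 1) x" by (simp add: E_def n_def)
  show "E Q \<in> sets lebesgue" by (simp add: EQ)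
  show "E Q \<subseteq> Q" using cell_subset_cube[of n x] Qn unfolding EQ by blast
  have "measure lebesgue (E Q) = side n ^ DIM('a) - side (n - 1) ^ DIM('a)"
    unfolding EQ using cell_mono[of "n - 1" n x]
    by (subst measurable_measure_Diff) (auto simp: measure_cell lmeasurable_cell)
  moreover have "side (n - 1) = side n / 2" using side_double[of "n - 1"] by simp
  moreover have "(2::real) ^ DIM('a) \<ge> 2" using DIM_positive by (metis Suc_leI one_le_numeral power_increasing power_one_right One_nat_def)
  then have "side n ^ DIM('a) / 2 ^ DIM('a) \<le> side n ^ DIM('a) / 2"
    using side_pos[of n] by (intro divide_left_mono) auto
  ultimately show "1/2 * measure lebesgue Q \<le> measure lebesgue (E Q)"
    by (simp add: Qn measure_cube power_divide)
  fix Q' assume Q': "Q' \<in> (\<lambda>n. cube n x) ` I" "Q \<noteq> Q'"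
  define m where "m = lev Q'"
  have Qm: "Q' = cube m x" using lev[OF Q'(1)] by (simp add: m_def)
  have EQ': "E Q' = cell m x - cell (m - 1) x" by (simp add: E_def m_def)
  have "n \<noteq> m" using Q'(2) Qn Qm by auto
  then consider "n \<le> m - 1" | "m \<le> n - 1" by linarith
  then show "E Q \<inter> E Q' = {}"
    using cell_mono[of n "m - 1" x] cell_mono[of m "n - 1" x] unfolding EQ EQ' by cases auto
qed

text \<open>A tower of nested cubes is sparse, so infinitely many averages bounded below would make the
  sparse operator infinite on a set of positive measure.\<close>

lemma finite_large_levels:
  assumes fin: "\<And>S. sparse S \<Longrightarrow> AE y in lebesgue. esparse S g y < \<infinity>" and "e > 0"
  shows "finite {n. m \<le> n \<and> ennreal e \<le> eavg (cell n x) g}" (is "finite ?I")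
proof (rule ccontr)
  assume inf: "infinite ?I"
  let ?S = "(\<lambda>n. cube n x) ` ?I"
  have "infinite ?S"
    using inf by (subst finite_image_iff) (auto intro!: inj_onI dest: cube_level_inj)
  have "esparse ?S g y = \<infinity>" if y: "y \<in> cell m x" for y
  proof -
    have "\<infinity> = (\<integral>\<^sup>+ Q. ennreal e \<partial>count_space ?S)"
      using \<open>infinite ?S\<close> \<open>e > 0\<close> by (simp add: ennreal_mult_top)
    also have "\<dots> \<le> esparse ?S g y"
      unfolding esparse_def
    proof (rule nn_integral_mono)
      fix Q assume "Q \<in> space (count_space ?S)"
      then obtain n where n: "m \<le> n" "ennreal e \<le> eavg (cell n x) g" "Q = cube n x" by auto
      have "y \<in> Q" using y cell_mono[OF n(1), of x] cell_subset_cube[of n x] n(3) by blast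
      then show "ennreal e \<le> eavg Q g * indicator Q y" using n by (simp add: eavg_cube)
    qed
    finally show ?thesis by (simp add: top_unique)
  qed
  then have "AE y in lebesgue. y \<notin> cell m x"
    using fin[OF sparse_tower[of x ?I]] by (auto elim!: eventually_mono)
  then have "cell m x \<in> null_sets lebesgue"
    using AE_iff_null_sets sets_cell by blast
  then show False using emeasure_cell_pos[of m x] by auto
qed


section \<open>Sparse domination of dyadic averages by record cells\<close>

text \<open>Comparing averages only through the powers of \<open>2 ^ (d + 1)\<close> that they exceed makes the average
  over a record cell at least twice the one over any record cell containing it, because a record
  average is at most \<open>2 ^ d\<close> times the power it exceeds.\<close>

definition record_level :: "('a \<Rightarrow> ennreal) \<Rightarrow> int \<Rightarrow> 'a \<Rightarrow> bool" where
  "record_level g m y \<longleftrightarrow> (\<exists>k::int. ennreal ((2 ^ (DIM('a) + 1)) powr k) < eavg (cell m y) g \<and>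
     (\<forall>m'>m. eavg (cell m' y) g \<le> ennreal ((2 ^ (DIM('a) + 1)) powr k)))"

lemma record_level_cong: "z \<in> cell m y \<Longrightarrow> record_level g m z = record_level g m y"
proof -
  assume z: "z \<in> cell m y"
  have "cell m z = cell m y" "\<And>m'. m < m' \<Longrightarrow> cell m' z = cell m' y"
    using cell_eq[OF z] cell_eq_le[OF z] by simp_all
  then show ?thesis by (simp add: record_level_def)
qed

text \<open>The smaller record cells lie where the averages reach \<open>2 * \<alpha>\<close>, and
  the weak-type estimate gives that set at most half of the cell.\<close>

lemma record_level_halving:
  assumes g: "g \<in> borel_measurable lebesgue" and fin: "eavg (cell n x) g < \<infinity>"
    and rec: "record_level g n x"
  shows "2 * emeasure lebesgue (cell n x \<inter> {y. \<exists>m\<le>n-1. record_level g m y}) \<le> emeasure lebesgue (cell n x)"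
proof -
  let ?b = "(2 ^ (DIM('a) + 1)) :: real" and ?U = "{y. \<exists>m\<le>n-1. record_level g m y}"
  define \<alpha> where "\<alpha> = enn2real (eavg (cell n x) g)"
  have \<alpha>: "eavg (cell n x) g = ennreal \<alpha>" "\<alpha> \<ge> 0" using fin by (simp_all add: \<alpha>_def)
  obtain k :: int where k: "ennreal (?b powr k) < eavg (cell n x) g"
    and kmax: "\<And>m'. m' > n \<Longrightarrow> eavg (cell m' x) g \<le> ennreal (?b powr k)"
    using rec unfolding record_level_def by blast
  have b1: "?b > 1" by (rule one_less_power) auto
  have \<alpha>k: "?b powr k < \<alpha>" using k by (simp add: \<alpha> ennreal_less_iff)
  then have "\<alpha> > 0" using order_le_less_trans powr_ge_zero by blast
  have "ennreal \<alpha> \<le> 2 ^ DIM('a) * eavg (cell (n + 1) x) g"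
    unfolding \<alpha>(1)[symmetric] by (rule eavg_cell_Suc)
  also have "\<dots> \<le> 2 ^ DIM('a) * ennreal (?b powr k)"
    by (intro mult_left_mono kmax) auto
  also have "\<dots> = ennreal (2 ^ DIM('a) * ?b powr k)"
    by (simp add: ennreal_mult flip: ennreal_power)
  finally have "\<alpha> \<le> 2 ^ DIM('a) * ?b powr k" by simp
  then have \<alpha>_le: "2 * \<alpha> \<le> ?b powr (k + 1)"
    using powr_int_Suc[of ?b k] by simp
  have "cell n x \<inter> ?U \<subseteq> cell n x \<inter> {y. \<exists>m\<le>n. ennreal (2 * \<alpha>) \<le> eavg (cell m y) g}"
  proof (intro subsetI IntI CollectI)
    fix y assume y: "y \<in> cell n x \<inter> ?U"
    then obtain m where m: "m \<le> n - 1" "record_level g m y" by blast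
    then obtain j :: int where j: "ennreal (?b powr j) < eavg (cell m y) g" "eavg (cell n y) g \<le> ennreal (?b powr j)"
      unfolding record_level_def by (metis zle_diff1_eq)
    \<comment> \<open>Level \<open>n\<close> lies above \<open>m\<close>, so its average is at most
      the \<open>j\<close>-th power while exceeding the \<open>k\<close>-th. Integrality of the
      exponents then gains a full factor \<open>?b\<close>.\<close>
    have "?b powr k < ?b powr j"
      using j(2) \<alpha>k y cell_eq[of y n x] by (simp add: \<alpha>)
    then have "real_of_int k < real_of_int j" using powr_less_cancel_iff[OF b1] by blast
    then have "real_of_int (k + 1) \<le> real_of_int j" by simp
    then have "?b powr (k + 1) \<le> ?b powr j" using powr_le_cancel_iff[OF b1] by blast
    with \<alpha>_le have "ennreal (2 * \<alpha>) \<le> ennreal (?b powr j)" by (intro ennreal_leI) simp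
    also have "\<dots> \<le> eavg (cell m y) g" using j(1) by (rule less_imp_le)
    finally show "\<exists>m\<le>n. ennreal (2 * \<alpha>) \<le> eavg (cell m y) g"
      using m(1) by (intro exI[of _ m]) simp
  qed auto
  then have "ennreal (2 * \<alpha>) * emeasure lebesgue (cell n x \<inter> ?U)
      \<le> ennreal (2 * \<alpha>) * emeasure lebesgue (cell n x \<inter> {y. \<exists>m\<le>n. ennreal (2 * \<alpha>) \<le> eavg (cell m y) g})"
    by (intro mult_left_mono emeasure_mono sets.Int sets_cell sets_stopped) (auto simp: eavg_cell_cong)
  also have "\<dots> \<le> (\<integral>\<^sup>+ y\<in>cell n x. g y \<partial>lebesgue)"
    by (rule dyadic_weak_type[OF g])
  also have "\<dots> = ennreal \<alpha> * emeasure lebesgue (cell n x)"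
    by (simp add: \<alpha> flip: eavg_mult_emeasure)
  finally have "ennreal \<alpha> * (2 * emeasure lebesgue (cell n x \<inter> ?U)) \<le> ennreal \<alpha> * emeasure lebesgue (cell n x)"
    using \<open>\<alpha> > 0\<close> by (simp add: ennreal_mult ac_simps)
  then show ?thesis
    using \<open>\<alpha> > 0\<close> by (simp add: ennreal_mult_le_mult_iff)
qed

text \<open>From each record cell the record cells of lower levels are removed. A point common to
  two pieces would have records at both levels, so the lower record would have been removed from the
  upper piece.\<close>

lemma sparse_record_cubes:
  assumes g: "g \<in> borel_measurable lebesgue" and fin: "\<And>n x. eavg (cell n x) g < \<infinity>"
  shows "sparse {cube n x | n x. record_level g n x}" (is "sparse ?S")
  unfolding sparse_def
proof (intro conjI exI ballI impI)
  define low where "low n = {y. \<exists>m\<le>n-1. record_level g m y}" for n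
  have [measurable]: "low n \<in> sets lebesgue" for n
    unfolding low_def by (rule sets_stopped) (rule record_level_cong)
  define rep where "rep Q = (SOME p. record_level g (fst p) (snd p) \<and> Q = cube (fst p) (snd p))" for Q
  have rep: "record_level g (fst (rep Q)) (snd (rep Q)) \<and> Q = cube (fst (rep Q)) (snd (rep Q))" if "Q \<in> ?S" for Q
    unfolding rep_def by (rule someI_ex) (use that in auto)
  define E where "E Q = cell (fst (rep Q)) (snd (rep Q)) - low (fst (rep Q))" for Q
  show "?S \<subseteq> cubes" using cube_in_cubes by blast
  fix Q assume Q: "Q \<in> ?S"
  obtain n x where nx: "rep Q = (n, x)" by fastforce
  have Qn: "Q = cube n x" "record_level g n x" using rep[OF Q] nx by auto
  have EQ: "E Q = cell n x - low n" by (simp add: E_def nx)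
  show "E Q \<in> sets lebesgue" by (simp add: EQ)
  show "E Q \<subseteq> Q" using cell_subset_cube[of n x] Qn unfolding EQ by blast
  have lm: "cell n x \<inter> low n \<in> lmeasurable"
    by (rule fmeasurableI2[OF lmeasurable_cell[of n x]]) auto
  have "2 * emeasure lebesgue (cell n x \<inter> low n) \<le> emeasure lebesgue (cell n x)"
    unfolding low_def by (rule record_level_halving[OF g fin Qn(2)])
  then have "2 * measure lebesgue (cell n x \<inter> low n) \<le> measure lebesgue (cell n x)"
    using lm lmeasurable_cell[of n x]
    by (simp add: emeasure_eq_measure2 flip: ennreal_numeral ennreal_mult)
  moreover have "measure lebesgue (E Q) = measure lebesgue (cell n x) - measure lebesgue (cell n x \<inter> low n)"
  proof -
    have "E Q = cell n x - (cell n x \<inter> low n)" unfolding EQ by blast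
    then show ?thesis using measurable_measure_Diff[OF lmeasurable_cell[of n x], of "cell n x \<inter> low n"] by simp
  qed
  ultimately show "1/2 * measure lebesgue Q \<le> measure lebesgue (E Q)"
    by (simp add: Qn(1) measure_cube measure_cell)
  fix Q' assume Q': "Q' \<in> ?S" "Q \<noteq> Q'"
  obtain n' x' where nx': "rep Q' = (n', x')" by fastforce
  have Qn': "Q' = cube n' x'" "record_level g n' x'" using rep[OF Q'(1)] nx' by auto
  have EQ': "E Q' = cell n' x' - low n'" by (simp add: E_def nx')
  show "E Q \<inter> E Q' = {}"
  proof (rule ccontr)
    assume "E Q \<inter> E Q' \<noteq> {}"
    then obtain y where y: "y \<in> cell n x" "y \<notin> low n" "y \<in> cell n' x'" "y \<notin> low n'"
      using EQ EQ' by blast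
    have "record_level g n y" "record_level g n' y"
      using y Qn(2) Qn'(2) record_level_cong by blast+
    then have "\<not> n' \<le> n - 1" "\<not> n \<le> n' - 1" using y(2,4) unfolding low_def by blast+
    then have "n = n'" by simp
    then have "cube n x = cube n' x'" using y cube_eq by metis
    with Q'(2) Qn Qn' show False by simp
  qed
qed

text \<open>Bracket the average between a power of \<open>?b\<close> and the next one. By
  \<open>large\<close> there is a highest level whose average still exceeds the lower power; it is a
  record, and its average is smaller than the given one by at most the factor
  \<open>?b\<close>.\<close>

lemma eavg_le_esparse_record:
  assumes fin: "\<And>n x. eavg (cell n x) g < \<infinity>"
    and large: "\<And>e m. e > 0 \<Longrightarrow> finite {n. m \<le> n \<and> ennreal e \<le> eavg (cell n x) g}"
  shows "eavg (cell m x) g \<le> ennreal (2 ^ (DIM('a) + 1)) * esparse {cube n x | n x. record_level g n x} g x"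
    (is "_ \<le> ennreal ?b * esparse ?S g x")
proof (cases "eavg (cell m x) g = 0")
  case False
  define \<alpha> where "\<alpha> = enn2real (eavg (cell m x) g)"
  have \<alpha>: "eavg (cell m x) g = ennreal \<alpha>" using fin by (simp add: \<alpha>_def)
  have "\<alpha> > 0" using False \<alpha> by (metis ennreal_eq_0_iff not_less)
  have "?b > 1" by (rule one_less_power) auto
  obtain k :: int where k: "?b powr k < \<alpha>" "\<alpha> \<le> ?b * ?b powr k"
    using powr_int_bracket[OF \<open>?b > 1\<close> \<open>\<alpha> > 0\<close>] by blast
  define I where "I = {n. m \<le> n \<and> ennreal (?b powr k) < eavg (cell n x) g}"
  have "finite I"
    by (rule finite_subset[OF _ large[of "?b powr k" m]]) (auto simp: I_def)
  have "m \<in> I" using k(1) by (simp add: I_def \<alpha> ennreal_less_iff)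
  define n where "n = Max I"
  have n: "n \<in> I" unfolding n_def using \<open>finite I\<close> \<open>m \<in> I\<close> by (intro Max_in) auto
  have "eavg (cell m' x) g \<le> ennreal (?b powr k)" if "m' > n" for m'
  proof (rule ccontr)
    assume "\<not> ?thesis"
    with that n have "m' \<in> I" by (auto simp: I_def)
    then show False using that \<open>finite I\<close> Max_ge unfolding n_def by fastforce
  qed
  then have "record_level g n x" using n unfolding record_level_def I_def by blast
  then have "cube n x \<in> ?S" by blast
  moreover have "x \<in> cube n x" using cell_subset_cube mem_cell by blast
  ultimately have "eavg (cell n x) g \<le> esparse ?S g x"
    using esparse_ge_single[of "cube n x" ?S x g] by (simp add: eavg_cube)
  have "eavg (cell m x) g \<le> ennreal (?b * ?b powr k)" unfolding \<alpha> using k(2) by (rule ennreal_leI)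
  also have "\<dots> = ennreal ?b * ennreal (?b powr k)" by (simp add: ennreal_mult)
  also have "\<dots> \<le> ennreal ?b * esparse ?S g x"
    using n \<open>eavg (cell n x) g \<le> esparse ?S g x\<close> by (intro mult_left_mono) (auto simp: I_def)
  finally show ?thesis .
qed simp

end

section \<open>The maximal operator of the shifted grids\<close>

text \<open>The alternating sign makes the shifted meshes of consecutive scales nested.\<close>

definition shift_off :: "'a::euclidean_space set \<Rightarrow> int \<Rightarrow> 'a \<Rightarrow> real" where
  "shift_off \<sigma> n i = (if i \<in> \<sigma> then (if even n then 1 else -1) * 2 powr n / 3 else 0)"

interpretation shifted: dyadic_grid "\<lambda>n. 2 powr (of_int n)" "shift_off \<sigma>" for \<sigma> :: "'a::euclidean_space set"
proof
  show "0 < 2 powr real_of_int n" for n by simp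
  show "2 powr real_of_int (n + 1) = 2 * 2 powr real_of_int n" for n by (simp add: powr_add)
  show "\<exists>j::int. shift_off \<sigma> n i - shift_off \<sigma> (n + 1) i = real_of_int j * 2 powr real_of_int n"
    for n and i :: 'a
    \<comment> \<open>Opposite signs turn the difference of offsets into a sum: one third plus two
      thirds of the mesh.\<close>
    by (rule exI[of _ "if i \<in> \<sigma> then (if even n then 1 else -1) else 0"])
      (auto simp: shift_off_def powr_add)
qed

text \<open>The one-third trick: an interval of length at most a third of the mesh cannot contain
  points of both the standard and the shifted lattice in its interior.\<close>

lemma floor_third_shift:
  fixes u s :: real and p :: int
  assumes "u < of_int p" "of_int p < u + 1/3" "s = 1/3 \<or> s = -1/3" "u \<le> y" "y < u + 1/3"
  shows "\<lfloor>y - s\<rfloor> = (if s = 1/3 then p - 1 else p)"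
  using assms by (auto simp: floor_eq_iff)

text \<open>The one-third trick is applied in each coordinate separately, which is why every subset
  of \<open>Basis\<close> is needed as a shift. The covering cell is named through an arbitrary
  point \<open>x\<close> of the box, since the maximal operator will be evaluated there.\<close>

lemma shifted_cell_cover:
  fixes p :: "'a::euclidean_space" and l :: real
  assumes "l > 0"
  shows "\<exists>\<sigma>\<subseteq>Basis. \<exists>n. 2 powr (of_int n) \<le> 6 * l \<and>
    (\<forall>x y. (\<forall>i\<in>Basis. p \<bullet> i \<le> x \<bullet> i \<and> x \<bullet> i < p \<bullet> i + l) \<longrightarrow>
           (\<forall>i\<in>Basis. p \<bullet> i \<le> y \<bullet> i \<and> y \<bullet> i < p \<bullet> i + l) \<longrightarrow> y \<in> shifted.cell \<sigma> n x)"
proof -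
  \<comment> \<open>The mesh \<open>h\<close> will satisfy \<open>3 * l \<le> h\<close> for the
    trick and \<open>h \<le> 6 * l\<close> for the measure comparison, the source of
    \<open>6 ^ DIM('a)\<close>.\<close>
  obtain k :: int where k: "2 powr k < 3 * l" "3 * l \<le> 2 * 2 powr k"
    using powr_int_bracket[of 2 "3 * l"] assms by auto
  define n where "n = k + 1"
  define h :: real where "h = 2 powr n"
  have h: "3 * l \<le> h" "h \<le> 6 * l" "h > 0" using k unfolding h_def n_def by (auto simp: powr_add)
  \<comment> \<open>The coordinates in which a point of the unshifted lattice falls inside the
    interval of length \<open>h / 3\<close> starting at \<open>p \<bullet> i\<close>; only these
    must be shifted.\<close>
  define \<sigma> where "\<sigma> = {i \<in> Basis. \<exists>m::int. p \<bullet> i / h < of_int m \<and> of_int m < p \<bullet> i / h + 1/3}"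
  have floor_const: "shifted.idx \<sigma> n x i = shifted.idx \<sigma> n y i"
    if i: "i \<in> Basis" and x: "p \<bullet> i \<le> x \<bullet> i" "x \<bullet> i < p \<bullet> i + l" and y: "p \<bullet> i \<le> y \<bullet> i" "y \<bullet> i < p \<bullet> i + l" for x y i
  proof -
    define u where "u = p \<bullet> i / h"
    have u: "u \<le> z \<bullet> i / h \<and> z \<bullet> i / h < u + 1/3" if "p \<bullet> i \<le> z \<bullet> i" "z \<bullet> i < p \<bullet> i + l" for z
      using that h by (auto simp: u_def field_simps)
    define s where "s = shift_off \<sigma> n i / h"
    have idx: "shifted.idx \<sigma> n z i = \<lfloor>z \<bullet> i / h - s\<rfloor>" for z
      unfolding shifted.idx_def s_def h_def by (simp add: diff_divide_distrib)
    show ?thesis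
    proof (cases "i \<in> \<sigma>")
      case True
      then obtain m :: int where m: "u < of_int m" "of_int m < u + 1/3" by (auto simp: \<sigma>_def u_def)
      have s: "s = 1/3 \<or> s = -1/3" using True h by (auto simp: s_def shift_off_def h_def)
      show ?thesis unfolding idx using floor_third_shift[OF m s] u[OF x] u[OF y] by simp
    next
      case False
      then have s: "s = 0" by (simp add: s_def shift_off_def)
      have no: "\<not> (u < of_int m \<and> of_int m < u + 1/3)" for m :: int
        using False i by (auto simp: \<sigma>_def u_def)
      have floor_u: "\<lfloor>z\<rfloor> = \<lfloor>u\<rfloor>" if "u \<le> z \<and> z < u + 1/3" for z
      proof (rule ccontr)
        assume "\<lfloor>z\<rfloor> \<noteq> \<lfloor>u\<rfloor>"
        then have "\<lfloor>u\<rfloor> < \<lfloor>z\<rfloor>" using that floor_mono[of u z] by simp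
        then have "u < of_int \<lfloor>z\<rfloor>" by linarith
        then show False using no[of "\<lfloor>z\<rfloor>"] that by linarith
      qed
      show ?thesis unfolding idx s using floor_u[OF u[OF x]] floor_u[OF u[OF y]] by simp
    qed
  qed
  show ?thesis
  proof (intro exI conjI allI impI)
    show "\<sigma> \<subseteq> Basis" by (auto simp: \<sigma>_def)
    show "2 powr (of_int n) \<le> 6 * l" using h by (simp add: h_def)
    fix x y :: 'a
    assume "\<forall>i\<in>Basis. p \<bullet> i \<le> x \<bullet> i \<and> x \<bullet> i < p \<bullet> i + l" "\<forall>i\<in>Basis. p \<bullet> i \<le> y \<bullet> i \<and> y \<bullet> i < p \<bullet> i + l"
    then show "y \<in> shifted.cell \<sigma> n x"
      unfolding shifted.cell_def using floor_const by blast
  qed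
qed

definition dyadic_max :: "('a::euclidean_space \<Rightarrow> ennreal) \<Rightarrow> 'a \<Rightarrow> ennreal" where
  "dyadic_max g x = (SUP \<sigma>\<in>Pow Basis. SUP n. eavg (shifted.cell \<sigma> n x) g)"

text \<open>Transfers the A1 condition from the fixed maximal operator to the cells of any grid: a
  shifted cell of at most 6 times the side covers the given one.\<close>

lemma (in dyadic_grid) eavg_cell_le_dyadic_max:
  "eavg (cell m x) g \<le> ennreal (6 ^ DIM('a)) * dyadic_max g x"
proof -
  obtain \<sigma> n where \<sigma>: "\<sigma> \<subseteq> Basis" and n: "2 powr (of_int n) \<le> 6 * side m"
    and sub: "\<And>x' y. (\<forall>i\<in>Basis. corner m x \<bullet> i \<le> x' \<bullet> i \<and> x' \<bullet> i < corner m x \<bullet> i + side m) \<Longrightarrow>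
           (\<forall>i\<in>Basis. corner m x \<bullet> i \<le> y \<bullet> i \<and> y \<bullet> i < corner m x \<bullet> i + side m) \<Longrightarrow> y \<in> shifted.cell \<sigma> n x'"
    using shifted_cell_cover[OF side_pos[of m], of "corner m x"] by blast
  let ?C = "shifted.cell \<sigma> n x"
  have subset: "cell m x \<subseteq> ?C"
    using sub[of x] mem_cell[of x m] unfolding cell_halfopen by blast
  have pos: "0 < side m ^ DIM('a)" using side_pos[of m] by simp
  have "(2 powr (of_int n)) ^ DIM('a) \<le> (6 * side m) ^ DIM('a)"
    using n by (intro power_mono) auto
  then have "emeasure lebesgue ?C \<le> ennreal (6 ^ DIM('a) * side m ^ DIM('a))"
    unfolding shifted.emeasure_cell by (intro ennreal_leI) (simp add: power_mult_distrib)
  then have meas: "emeasure lebesgue ?C \<le> ennreal (6 ^ DIM('a)) * emeasure lebesgue (cell m x)"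
    using pos by (simp add: emeasure_cell ennreal_mult)
  have "eavg (cell m x) g * emeasure lebesgue (cell m x) = (\<integral>\<^sup>+ y\<in>cell m x. g y \<partial>lebesgue)"
    by (rule eavg_mult_emeasure)
  also have "\<dots> \<le> (\<integral>\<^sup>+ y\<in>?C. g y \<partial>lebesgue)"
    using subset by (intro nn_integral_mono) (auto simp: indicator_def)
  also have "\<dots> = eavg ?C g * emeasure lebesgue ?C"
    by (rule shifted.eavg_mult_emeasure[symmetric])
  also have "\<dots> \<le> eavg ?C g * (ennreal (6 ^ DIM('a)) * emeasure lebesgue (cell m x))"
    using meas by (rule mult_left_mono) simp
  finally have "emeasure lebesgue (cell m x) * eavg (cell m x) g
      \<le> emeasure lebesgue (cell m x) * (ennreal (6 ^ DIM('a)) * eavg ?C g)"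
    by (simp add: ac_simps)
  then have "eavg (cell m x) g \<le> ennreal (6 ^ DIM('a)) * eavg ?C g"
    using emeasure_cell_pos[of m x] emeasure_cell_finite[of m x]
    by (subst (asm) ennreal_mult_le_mult_iff) auto
  also have "\<dots> \<le> ennreal (6 ^ DIM('a)) * dyadic_max g x"
    unfolding dyadic_max_def using \<sigma> by (intro mult_left_mono SUP_upper2[of \<sigma>] SUP_upper) auto
  finally show ?thesis .
qed

text \<open>The average takes one value on each of countably many cells.\<close>

lemma (in dyadic_grid) borel_measurable_eavg_cell: "(\<lambda>x. eavg (cell n x) g) \<in> borel_measurable lebesgue"
proof (rule measurable_compose_countable'[where f = "\<lambda>P x. eavg P g" and g = "cell n" and I = "range (cell n)"])
  show "cell n \<in> measurable lebesgue (count_space (range (cell n)))"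
  proof (subst measurable_count_space_eq_countable[OF countable_cells], intro conjI ballI)
    fix P assume "P \<in> range (cell n)"
    then obtain z where P: "P = cell n z" by blast
    have "cell n y = cell n z \<longleftrightarrow> y \<in> cell n z" for y
      by (metis cell_eq mem_cell)
    then have "cell n -` {P} \<inter> space lebesgue = P"
      unfolding P vimage_def by simp
    then show "cell n -` {P} \<inter> space lebesgue \<in> sets lebesgue" by (simp add: P)
  qed auto
qed (auto intro: countable_cells)

lemma borel_measurable_dyadic_max [measurable]: "dyadic_max g \<in> borel_measurable lebesgue"
proof -
  have "finite (Pow (Basis :: 'a set))" by simp
  then show ?thesis unfolding dyadic_max_def[abs_def]
    by (intro borel_measurable_SUP shifted.borel_measurable_eavg_cell) (auto intro: countable_finite)
qed

lemma eavg_cmult: "g \<in> borel_measurable lebesgue \<Longrightarrow> Q \<in> sets lebesgue \<Longrightarrow> eavg Q (\<lambda>x. c * g x) = c * eavg Q g"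
  by (simp add: eavg_def nn_integral_cmult mult.assoc ennreal_times_divide)

lemma eavg_suminf:
  assumes [measurable]: "\<And>k. F k \<in> borel_measurable lebesgue" "Q \<in> sets lebesgue"
  shows "eavg Q (\<lambda>x. \<Sum>k. F k x) = (\<Sum>k. eavg Q (F k))"
proof -
  have "(\<integral>\<^sup>+ y\<in>Q. (\<Sum>k. F k y) \<partial>lebesgue) = (\<Sum>k. \<integral>\<^sup>+ y\<in>Q. F k y \<partial>lebesgue)"
    by (simp add: nn_integral_suminf flip: ennreal_suminf_multc)
  then show ?thesis by (simp add: eavg_def divide_ennreal_def)
qed

lemma eavg_shifted_le_dyadic_max: "\<sigma> \<subseteq> Basis \<Longrightarrow> eavg (shifted.cell \<sigma> n x) g \<le> dyadic_max g x"
  unfolding dyadic_max_def by (intro SUP_upper2[of \<sigma>] SUP_upper) auto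

text \<open>Countable sublinearity, which makes the weighted series of iterates an A1
  weight.\<close>

lemma dyadic_max_suminf:
  assumes "\<And>k. F k \<in> borel_measurable lebesgue"
  shows "dyadic_max (\<lambda>x. \<Sum>k. ennreal (c k) * F k x) x \<le> (\<Sum>k. ennreal (c k) * dyadic_max (F k) x)"
  unfolding dyadic_max_def[of "\<lambda>x. \<Sum>k. ennreal (c k) * F k x"]
proof (intro SUP_least)
  fix \<sigma> :: "'a set" and n assume "\<sigma> \<in> Pow Basis"
  then show "eavg (shifted.cell \<sigma> n x) (\<lambda>x. \<Sum>k. ennreal (c k) * F k x) \<le> (\<Sum>k. ennreal (c k) * dyadic_max (F k) x)"
    using assms
    by (simp add: eavg_suminf eavg_cmult shifted.sets_cell)
      (intro suminf_le mult_left_mono eavg_shifted_le_dyadic_max; simp)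
qed

section \<open>Infinite sums in quasi-Banach function spaces\<close>

locale qbfs =
  fixes X :: "('a::euclidean_space \<Rightarrow> real) set" and nX :: "('a \<Rightarrow> real) \<Rightarrow> real"
  assumes qBFS: "qBFS X nX"
begin

lemma measurable_X: "f \<in> X \<Longrightarrow> f \<in> borel_measurable lebesgue"
  and norm_nonneg: "f \<in> X \<Longrightarrow> 0 \<le> nX f"
  and norm_eq_0: "f \<in> X \<Longrightarrow> nX f = 0 \<longleftrightarrow> (AE x in lebesgue. f x = 0)"
  and scale_X: "f \<in> X \<Longrightarrow> (\<lambda>x. c * f x) \<in> X"
  and norm_scale: "f \<in> X \<Longrightarrow> nX (\<lambda>x. c * f x) = \<bar>c\<bar> * nX f"
  and ideal_X: "f \<in> X \<Longrightarrow> g \<in> borel_measurable lebesgue \<Longrightarrow> AE x in lebesgue. \<bar>g x\<bar> \<le> \<bar>f x\<bar> \<Longrightarrow> g \<in> X"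
  and norm_mono: "f \<in> X \<Longrightarrow> g \<in> borel_measurable lebesgue \<Longrightarrow> AE x in lebesgue. \<bar>g x\<bar> \<le> \<bar>f x\<bar> \<Longrightarrow> nX g \<le> nX f"
  and saturation: "\<And>E. E \<in> sets lebesgue \<Longrightarrow> emeasure lebesgue E > 0 \<Longrightarrow>
    \<exists>F\<in>sets lebesgue. F \<subseteq> E \<and> emeasure lebesgue F > 0 \<and> indicator F \<in> X"
  and complete_X: "\<And>u. (\<And>n. u n \<in> X) \<Longrightarrow> (\<And>e. e > 0 \<Longrightarrow> \<exists>N. \<forall>m\<ge>N. \<forall>n\<ge>N. nX (\<lambda>x. u m x - u n x) < e)
    \<Longrightarrow> \<exists>f\<in>X. (\<lambda>n. nX (\<lambda>x. u n x - f x)) \<longlonglongrightarrow> 0"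
  using qBFS unfolding qBFS_def by (blast | metis)+

definition K :: real where "K = KX X nX"

lemma quasi_const_exists: "\<exists>K\<ge>1. \<forall>f\<in>X. \<forall>g\<in>X. (\<lambda>x. f x + g x) \<in> X \<and> nX (\<lambda>x. f x + g x) \<le> K * (nX f + nX g)"
  using qBFS unfolding qBFS_def by blast

lemma add_X: "f \<in> X \<Longrightarrow> g \<in> X \<Longrightarrow> (\<lambda>x. f x + g x) \<in> X"
  using quasi_const_exists by blast

lemma K_ge_1: "K \<ge> 1"
  unfolding K_def KX_def by (rule cInf_greatest) (use quasi_const_exists in auto)

text \<open>The infimum in \<open>KX\<close> is itself admissible: divide by
  \<open>nX f + nX g\<close>, and if this vanishes any admissible constant already gives the
  claim.\<close>

lemma quasi_triangle:
  assumes "f \<in> X" "g \<in> X"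
  shows "nX (\<lambda>x. f x + g x) \<le> K * (nX f + nX g)"
proof -
  let ?A = "{K. K \<ge> 1 \<and> (\<forall>f\<in>X. \<forall>g\<in>X. nX (\<lambda>x. f x + g x) \<le> K * (nX f + nX g))}"
  have ne: "?A \<noteq> {}" using quasi_const_exists by blast
  have s: "nX f + nX g \<ge> 0" using norm_nonneg assms by (simp add: add_nonneg_nonneg)
  show ?thesis
  proof (cases "nX f + nX g = 0")
    case True
    obtain K' where "nX (\<lambda>x. f x + g x) \<le> K' * (nX f + nX g)" using ne assms by blast
    then show ?thesis using True by simp
  next
    case False
    then have pos: "nX f + nX g > 0" using s by simp
    have "nX (\<lambda>x. f x + g x) / (nX f + nX g) \<le> Inf ?A"
      by (rule cInf_greatest[OF ne]) (use pos assms in \<open>auto simp: divide_le_eq\<close>)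
    then show ?thesis using pos by (simp add: K_def KX_def divide_le_eq)
  qed
qed

text \<open>Finiteness almost everywhere is part of the notion because \<open>enn2real\<close> sends
  infinity to 0, so the norm bound alone would not detect infinite values.\<close>

definition norm_le :: "('a \<Rightarrow> ennreal) \<Rightarrow> real \<Rightarrow> bool" where
  "norm_le G b \<longleftrightarrow> G \<in> borel_measurable lebesgue \<and> (AE x in lebesgue. G x < \<infinity>) \<and>
    (\<lambda>x. enn2real (G x)) \<in> X \<and> nX (\<lambda>x. enn2real (G x)) \<le> b"

lemma norm_leD:
  assumes "norm_le G b"
  shows "G \<in> borel_measurable lebesgue" "AE x in lebesgue. G x < \<infinity>"
    "(\<lambda>x. enn2real (G x)) \<in> X" "nX (\<lambda>x. enn2real (G x)) \<le> b"
  using assms unfolding norm_le_def by auto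

lemma norm_le_dominated:
  assumes f: "f \<in> X" and G[measurable]: "G \<in> borel_measurable lebesgue"
    and le: "AE x in lebesgue. G x \<le> ennreal \<bar>f x\<bar>"
  shows "norm_le G (nX f)"
proof -
  have m: "(\<lambda>x. enn2real (G x)) \<in> borel_measurable lebesgue" by measurable
  have le': "AE x in lebesgue. \<bar>enn2real (G x)\<bar> \<le> \<bar>f x\<bar>"
    using le by eventually_elim (simp add: enn2real_leI)
  have "AE x in lebesgue. G x < \<infinity>"
    using le by eventually_elim (auto intro: order.strict_trans1)
  then show ?thesis
    unfolding norm_le_def using ideal_X[OF f m le'] norm_mono[OF f m le'] G by simp
qed

lemma norm_le_weaken: "norm_le G b \<Longrightarrow> b \<le> b' \<Longrightarrow> norm_le G b'"
  by (auto simp: norm_le_def)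

lemma norm_le_mono:
  assumes "norm_le G b" "F \<in> borel_measurable lebesgue" "AE x in lebesgue. F x \<le> G x"
  shows "norm_le F b"
proof -
  have "AE x in lebesgue. F x \<le> ennreal \<bar>enn2real (G x)\<bar>"
    using assms(3) norm_leD(2)[OF assms(1)] by eventually_elim simp
  then have "norm_le F (nX (\<lambda>x. enn2real (G x)))"
    using norm_leD(3)[OF assms(1)] assms(2) by (intro norm_le_dominated)
  then show ?thesis using norm_le_weaken norm_leD(4)[OF assms(1)] by blast
qed

lemma norm_le_cmult:
  assumes "norm_le G b" "c \<ge> 0"
  shows "norm_le (\<lambda>x. ennreal c * G x) (c * b)"
proof -
  note G = norm_leD[OF assms(1)]
  have "AE x in lebesgue. ennreal c * G x \<le> ennreal \<bar>c * enn2real (G x)\<bar>"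
    using G(2) by eventually_elim (use assms(2) in \<open>simp add: ennreal_mult abs_mult\<close>)
  then have "norm_le (\<lambda>x. ennreal c * G x) (nX (\<lambda>x. c * enn2real (G x)))"
    using G(1) by (intro norm_le_dominated scale_X G(3)) auto
  then show ?thesis
    by (rule norm_le_weaken) (use G assms(2) in \<open>simp add: norm_scale mult_left_mono\<close>)
qed

lemma norm_le_add:
  assumes "norm_le F a" "norm_le G b"
  shows "norm_le (\<lambda>x. F x + G x) (K * (a + b))"
proof -
  note F = norm_leD[OF assms(1)] and G = norm_leD[OF assms(2)]
  have "AE x in lebesgue. F x + G x \<le> ennreal \<bar>enn2real (F x) + enn2real (G x)\<bar>"
    using F(2) G(2) by eventually_elim simp
  then have "norm_le (\<lambda>x. F x + G x) (nX (\<lambda>x. enn2real (F x) + enn2real (G x)))"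
    using F(1) G(1) by (intro norm_le_dominated add_X F(3) G(3)) auto
  moreover have "nX (\<lambda>x. enn2real (F x) + enn2real (G x)) \<le> K * (a + b)"
    using quasi_triangle[OF F(3) G(3)] mult_left_mono[of "nX (\<lambda>x. enn2real (F x)) + nX (\<lambda>x. enn2real (G x))" "a + b" K]
      F(4) G(4) K_ge_1 by linarith
  ultimately show ?thesis by (rule norm_le_weaken)
qed

lemma X_nonempty: "\<exists>f. f \<in> X \<and> nX f > 0"
proof -
  obtain F where F: "F \<in> sets lebesgue" "emeasure lebesgue F > 0" "indicator F \<in> X"
    using saturation[of UNIV] by (auto simp: emeasure_completion)
  have "nX (indicator F) \<noteq> 0"
  proof
    assume "nX (indicator F) = 0"
    then have "AE x in lebesgue. indicator F x = (0::real)" using norm_eq_0[OF F(3)] by simp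
    then have "AE x in lebesgue. x \<notin> F" by eventually_elim (simp add: indicator_def split: if_splits)
    then show False using F AE_iff_null_sets[OF F(1)] by (auto simp: null_sets_def)
  qed
  then show ?thesis using norm_nonneg[OF F(3)] F(3) by (intro exI[of _ "indicator F"]) simp
qed

lemma norm_le_zero: "norm_le (\<lambda>_. 0) 0"
proof -
  obtain f where f: "f \<in> X" using X_nonempty by blast
  have "norm_le (\<lambda>_. 0) (nX (\<lambda>x. 0 * f x))"
    using f by (intro norm_le_dominated scale_X) auto
  then show ?thesis using norm_scale[OF f, of 0] by simp
qed

text \<open>The exponential constant is affordable: the sum will run over the shifted grids, whose
  number depends only on the dimension.\<close>

lemma norm_le_sum:
  assumes "finite I" "\<And>i. i \<in> I \<Longrightarrow> norm_le (F i) b" "b \<ge> 0"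
  shows "norm_le (\<lambda>x. \<Sum>i\<in>I. F i x) ((2 * K) ^ card I * b)"
  using assms
proof (induction I rule: finite_induct)
  case empty
  then show ?case using norm_le_weaken[OF norm_le_zero] by simp
next
  case (insert i I)
  have "norm_le (\<lambda>x. F i x + (\<Sum>i\<in>I. F i x)) (K * (b + (2 * K) ^ card I * b))"
    using insert by (intro norm_le_add) auto
  moreover have "K * (b + (2 * K) ^ card I * b) \<le> (2 * K) ^ card (insert i I) * b"
  proof -
    have "1 * b \<le> (2 * K) ^ card I * b"
      using insert K_ge_1 one_le_power[of "2 * K" "card I"] by (intro mult_right_mono) auto
    then have "K * (b + (2 * K) ^ card I * b) \<le> K * (2 * ((2 * K) ^ card I * b))"
      using K_ge_1 by (intro mult_left_mono) linarith+
    also have "\<dots> = (2 * K) ^ card (insert i I) * b" using insert by simp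
    finally show ?thesis .
  qed
  ultimately show ?case using insert by (auto intro: norm_le_weaken)
qed

text \<open>The partial sums are Cauchy, and their limit in \<open>X\<close> dominates the series
  almost everywhere. One factor \<open>2 * K\<close> bounds the partial sums; the remaining
  \<open>K\<close> is paid for passing to the limit.\<close>

lemma norm_le_suminf:
  assumes F: "\<And>k. norm_le (F k) (b * (1 / (2 * K)) ^ k)" and b: "b \<ge> 0"
  shows "norm_le (\<lambda>x. \<Sum>k. F k x) (2 * K\<^sup>2 * b)"
proof -
  let ?q = "1 / (2 * K)"
  have q: "0 < ?q" "?q < 1" using K_ge_1 by (auto simp: field_simps)
  have Fm[measurable]: "F k \<in> borel_measurable lebesgue" for k using norm_leD(1)[OF F] .
  \<comment> \<open>Terms are split off from the front, so each further \<open>K\<close> meets a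
    further factor \<open>?q = 1 / (2 * K)\<close>; the bound reproduces itself as
    \<open>K * (1 + 1)\<close>.\<close>
  have tail: "norm_le (\<lambda>x. \<Sum>k\<in>{m..<m + j}. F k x) (2 * K * b * ?q ^ m)" for m j
  proof (induction j arbitrary: m)
    case 0
    have "0 \<le> 2 * K * b * ?q ^ m" using K_ge_1 b by simp
    then show ?case using norm_le_weaken[OF norm_le_zero] by simp
  next
    case (Suc j)
    have "(\<Sum>k\<in>{m..<m + Suc j}. F k x) = F m x + (\<Sum>k\<in>{Suc m..<Suc m + j}. F k x)" for x
      by (simp add: sum.atLeast_Suc_lessThan)
    moreover have "norm_le (\<lambda>x. F m x + (\<Sum>k\<in>{Suc m..<Suc m + j}. F k x)) (K * (b * ?q ^ m + 2 * K * b * ?q ^ Suc m))"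
      by (intro norm_le_add F Suc.IH)
    moreover have "K * (b * ?q ^ m + 2 * K * b * ?q ^ Suc m) = 2 * K * b * ?q ^ m"
      using K_ge_1 by (simp add: field_simps)
    ultimately show ?case by (simp only:)
  qed
  define U where "U n x = (\<Sum>k<n. F k x)" for n x
  define u where "u n x = enn2real (U n x)" for n x
  have U: "norm_le (U n) (2 * K * b)" for n
    using tail[of 0 n] by (simp add: U_def[abs_def] lessThan_atLeast0)
  have uX: "u n \<in> X" for n using norm_leD(3)[OF U] by (simp add: u_def[abs_def])
  have Ufin: "AE x in lebesgue. \<forall>n. U n x < \<infinity>"
    using norm_leD(2)[OF U] by (simp add: AE_all_countable)
  have U_split: "U n x = U m x + (\<Sum>k\<in>{m..<n}. F k x)" if "m \<le> n" for m n x
    using sum.atLeastLessThan_concat[of 0 m n "\<lambda>k. F k x"] that by (simp add: U_def lessThan_atLeast0)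
  have diff: "nX (\<lambda>x. u m x - u n x) \<le> 2 * K * b * ?q ^ m" if "m \<le> n" for m n
  proof -
    let ?T = "\<lambda>x. \<Sum>k\<in>{m..<n}. F k x"
    have T: "norm_le ?T (2 * K * b * ?q ^ m)" using tail[of m "n - m"] that by simp
    have "AE x in lebesgue. \<bar>u m x - u n x\<bar> \<le> \<bar>enn2real (?T x)\<bar>"
      using Ufin norm_leD(2)[OF T]
    proof eventually_elim
      case (elim x)
      then have "u n x = u m x + enn2real (?T x)"
        unfolding u_def U_split[OF that] by (intro enn2real_plus) auto
      then show ?case by simp
    qed
    then have "nX (\<lambda>x. u m x - u n x) \<le> nX (\<lambda>x. enn2real (?T x))"
      using measurable_X[OF uX] by (intro norm_mono[OF norm_leD(3)[OF T]]) auto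
    then show ?thesis using norm_leD(4)[OF T] by simp
  qed
  have sym: "nX (\<lambda>x. f x - g x) = nX (\<lambda>x. g x - f x)" if "(\<lambda>x. g x - f x) \<in> X" for f g
    using norm_scale[OF that, of "-1"] by simp
  have diff_X: "(\<lambda>x. f x - g x) \<in> X" if "f \<in> X" "g \<in> X" for f g
    using add_X[OF that(1) scale_X[OF that(2), of "-1"]] by simp
  have "\<exists>f\<in>X. (\<lambda>n. nX (\<lambda>x. u n x - f x)) \<longlonglongrightarrow> 0"
  proof (rule complete_X[OF uX])
    fix e :: real assume "e > 0"
    have "(\<lambda>m. 2 * K * b * ?q ^ m) \<longlonglongrightarrow> 2 * K * b * 0"
      using q by (intro tendsto_mult LIMSEQ_power_zero) auto
    then have "eventually (\<lambda>m. 2 * K * b * ?q ^ m < e) sequentially"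
      using \<open>e > 0\<close> by (intro order_tendstoD(2)) auto
    then obtain N where N: "\<And>m. m \<ge> N \<Longrightarrow> 2 * K * b * ?q ^ m < e"
      unfolding eventually_sequentially by blast
    show "\<exists>N. \<forall>m\<ge>N. \<forall>n\<ge>N. nX (\<lambda>x. u m x - u n x) < e"
    proof (intro exI[of _ N] allI impI)
      fix m n assume mn: "m \<ge> N" "n \<ge> N"
      show "nX (\<lambda>x. u m x - u n x) < e"
      proof (cases "m \<le> n")
        case True
        then show ?thesis using diff[OF True] N[OF mn(1)] by simp
      next
        case False
        then show ?thesis
          using diff[of n m] N[OF mn(2)] sym[OF diff_X[OF uX[of n] uX[of m]]] by simp
      qed
    qed
  qed
  then obtain f where f: "f \<in> X" and lim: "(\<lambda>n. nX (\<lambda>x. u n x - f x)) \<longlonglongrightarrow> 0" by blast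
  have fm[measurable]: "f \<in> borel_measurable lebesgue" by (rule measurable_X[OF f])
  have um[measurable]: "u n \<in> borel_measurable lebesgue" for n by (rule measurable_X[OF uX])
  have "AE x in lebesgue. u n x \<le> f x" for n
  proof -
    \<comment> \<open>Norm convergence gives no pointwise limit directly. Instead the positive part
      of \<open>u n - f\<close> is dominated by \<open>u m - f\<close> for all later
      \<open>m\<close>, so its norm is 0.\<close>
    let ?p = "\<lambda>x. max 0 (u n x - f x)"
    have le: "AE x in lebesgue. \<bar>?p x\<bar> \<le> \<bar>u m x - f x\<bar>" if "n \<le> m" for m
      using Ufin
    proof eventually_elim
      case (elim x)
      have "U n x \<le> U m x" using U_split[OF that, of x] by simp
      with elim have "u n x \<le> u m x"
        unfolding u_def by (intro enn2real_mono) auto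
      then show ?case by auto
    qed
    have p: "?p \<in> X" by (rule ideal_X[OF diff_X[OF uX f] _ le[OF order_refl]]) measurable
    have "nX ?p \<le> nX (\<lambda>x. u m x - f x)" if "n \<le> m" for m
      by (rule norm_mono[OF diff_X[OF uX f] _ le[OF that]]) measurable
    then have "nX ?p \<le> 0"
      by (intro LIMSEQ_le_const[OF lim]) auto
    then have "AE x in lebesgue. ?p x = 0"
      using norm_nonneg[OF p] norm_eq_0[OF p] by simp
    then show ?thesis by eventually_elim (simp add: max_def split: if_splits)
  qed
  then have "AE x in lebesgue. \<forall>n. u n x \<le> f x" by (simp add: AE_all_countable)
  then have "AE x in lebesgue. (\<Sum>k. F k x) \<le> ennreal \<bar>f x\<bar>"
    using Ufin
  proof eventually_elim
    case (elim x)
    have "U n x \<le> ennreal \<bar>f x\<bar>" for n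
    proof -
      have "U n x = ennreal (u n x)" using elim(2) by (simp add: u_def)
      then show ?thesis using elim(1) by (metis abs_ge_self ennreal_leI order_trans)
    qed
    then show ?case unfolding U_def by (intro suminf_le_const) auto
  qed
  then have "norm_le (\<lambda>x. \<Sum>k. F k x) (nX f)" by (intro norm_le_dominated f) auto
  moreover have "nX f \<le> 2 * K\<^sup>2 * b"
  proof -
    \<comment> \<open>A quasi-norm need not be continuous, so the norm of the limit is estimated
      through the quasi-triangle inequality.\<close>
    have "nX f \<le> K * (nX (\<lambda>x. u n x - f x) + 2 * K * b)" for n
    proof -
      have "nX (\<lambda>x. (f x - u n x) + u n x) \<le> K * (nX (\<lambda>x. f x - u n x) + nX (u n))"
        by (intro quasi_triangle diff_X f uX)
      moreover have "nX (\<lambda>x. f x - u n x) = nX (\<lambda>x. u n x - f x)" by (rule sym[OF diff_X[OF uX f]])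
      moreover have "nX (u n) \<le> 2 * K * b" using norm_leD(4)[OF U[of n]] by (simp add: u_def[abs_def])
      then have "K * (nX (\<lambda>x. u n x - f x) + nX (u n)) \<le> K * (nX (\<lambda>x. u n x - f x) + 2 * K * b)"
        using K_ge_1 by (intro mult_left_mono) auto
      ultimately show ?thesis by simp
    qed
    moreover have "(\<lambda>n. K * (nX (\<lambda>x. u n x - f x) + 2 * K * b)) \<longlonglongrightarrow> K * (0 + 2 * K * b)"
      by (intro tendsto_intros lim)
    ultimately have "nX f \<le> K * (0 + 2 * K * b)"
      by (intro LIMSEQ_le_const) auto
    then show ?thesis by (simp add: power2_eq_square ac_simps)
  qed
  ultimately show ?thesis by (rule norm_le_weaken)
qed

end

section \<open>Self-improvement of the sparse bound\<close>

text \<open>A single cube is a sparse family, and an infinite average would make its operator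
  infinite on a set of positive measure.\<close>

lemma (in dyadic_grid) eavg_cell_finite:
  assumes "\<And>S. sparse S \<Longrightarrow> AE y in lebesgue. esparse S g y < \<infinity>"
  shows "eavg (cell n x) g < \<infinity>"
proof (rule ccontr)
  assume inf: "\<not> eavg (cell n x) g < \<infinity>"
  have "AE y in lebesgue. esparse {cube n x} g y < \<infinity>"
    using assms[OF sparse_tower[of x "{n}"]] by simp
  then have "AE y in lebesgue. y \<notin> cell n x"
  proof eventually_elim
    case (elim y)
    show ?case
    proof
      assume "y \<in> cell n x"
      then have "eavg (cell n x) g \<le> esparse {cube n x} g y"
        using esparse_ge_single[of "cube n x" "{cube n x}" y g] cell_subset_cube[of n x] by (auto simp: eavg_cube)
      with elim inf show False by auto
    qed
  qed
  then have "cell n x \<in> null_sets lebesgue"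
    using AE_iff_null_sets sets_cell by blast
  then show False using emeasure_cell_pos[of n x] by auto
qed

lemma eavg_cong_AE: "AE y in lebesgue. g y = h y \<Longrightarrow> eavg Q g = eavg Q h"
  unfolding eavg_def by (intro arg_cong2[of _ _ _ _ "(/)"] nn_integral_cong_AE) (auto elim: eventually_mono)

lemma eavg_mono_AE: "AE y in lebesgue. g y \<le> h y \<Longrightarrow> eavg Q g \<le> eavg Q h"
  unfolding eavg_def by (intro divide_right_mono_ennreal nn_integral_mono_AE)
    (auto elim!: eventually_mono intro: mult_right_mono)

lemma sparse_empty: "sparse {}"
  by (simp add: sparse_def)

locale asparse_space = qbfs X nX for X :: "('a::euclidean_space \<Rightarrow> real) set" and nX +
  fixes C :: real
  assumes bound: "Asparse_bound X nX C"
begin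

lemma C_nonneg: "C \<ge> 0"
proof -
  obtain f where f: "f \<in> X" "nX f > 0" using X_nonempty by blast
  have "(\<lambda>x. enn2real (sparse_op {} f x)) \<in> X" "nX (\<lambda>x. enn2real (sparse_op {} f x)) \<le> C * nX f"
    using bound sparse_empty f(1) unfolding Asparse_bound_def by blast+
  then have "0 \<le> C * nX f" using norm_nonneg order_trans by blast
  then show ?thesis using f(2) by (simp add: zero_le_mult_iff)
qed

lemma norm_le_esparse:
  assumes G: "norm_le G b" and S: "sparse S"
  shows "norm_le (esparse S G) (C * b)"
proof -
  let ?f = "\<lambda>x. enn2real (G x)"
  have "AE y in lebesgue. ennreal \<bar>?f y\<bar> = G y"
    using norm_leD(2)[OF G] by eventually_elim simp
  then have "eavg Q (\<lambda>y. ennreal \<bar>?f y\<bar>) = eavg Q G" for Q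
    by (rule eavg_cong_AE)
  then have eq: "sparse_op S ?f = esparse S G"
    unfolding sparse_op_eq_esparse esparse_def[abs_def] by (simp only:)
  have "(AE x in lebesgue. sparse_op S ?f x < \<infinity>) \<and> (\<lambda>x. enn2real (sparse_op S ?f x)) \<in> X \<and>
      nX (\<lambda>x. enn2real (sparse_op S ?f x)) \<le> C * nX ?f"
    using bound S norm_leD(3)[OF G] unfolding Asparse_bound_def by blast
  moreover have "C * nX ?f \<le> C * b" using norm_leD(4)[OF G] C_nonneg by (rule mult_left_mono)
  ultimately show ?thesis
    unfolding norm_le_def eq using borel_measurable_esparse[OF S] by auto
qed

text \<open>Bounds \<open>dyadic_max\<close> on \<open>X\<close>:
  \<open>2 ^ (DIM('a) + 1) * C\<close> for each grid, summed over the grids by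
  \<open>norm_le_sum\<close>. The \<open>max 1\<close> keeps \<open>2 * K * B\<close> at least 1
  when \<open>C\<close> is small.\<close>

definition B :: real where
  "B = max 1 ((2 * K) ^ card (Pow (Basis :: 'a set)) * (2 ^ (DIM('a) + 1) * C))"

text \<open>The record families depend on \<open>G\<close>, which is harmless because the sparse
  bound is uniform over all families.\<close>

lemma norm_le_dyadic_max:
  assumes G: "norm_le G b" and b: "b \<ge> 0"
  shows "norm_le (dyadic_max G) (B * b)"
proof -
  let ?a = "2 ^ (DIM('a) + 1) :: real"
  have fin: "AE y in lebesgue. esparse S G y < \<infinity>" if "sparse S" for S
    using norm_leD(2)[OF norm_le_esparse[OF G that]] .
  have Gm: "G \<in> borel_measurable lebesgue" by (rule norm_leD(1)[OF G])
  define S where "S \<sigma> = {shifted.cube \<sigma> n x | n x. shifted.record_level \<sigma> G n x}" for \<sigma> :: "'a set"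
  have S: "sparse (S \<sigma>)" for \<sigma>
    unfolding S_def by (intro shifted.sparse_record_cubes Gm shifted.eavg_cell_finite fin)
  have le: "eavg (shifted.cell \<sigma> n x) G \<le> ennreal ?a * esparse (S \<sigma>) G x" for \<sigma> n x
    unfolding S_def by (intro shifted.eavg_le_esparse_record shifted.eavg_cell_finite shifted.finite_large_levels fin)
  have sum: "norm_le (\<lambda>x. \<Sum>\<sigma>\<in>Pow Basis. ennreal ?a * esparse (S \<sigma>) G x)
      ((2 * K) ^ card (Pow (Basis :: 'a set)) * (?a * (C * b)))"
    using C_nonneg b by (intro norm_le_sum norm_le_cmult norm_le_esparse G S) auto
  have "dyadic_max G x \<le> (\<Sum>\<sigma>\<in>Pow Basis. ennreal ?a * esparse (S \<sigma>) G x)" for x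
    unfolding dyadic_max_def
  proof (intro SUP_least)
    fix \<sigma> :: "'a set" and n assume \<sigma>: "\<sigma> \<in> Pow Basis"
    have "ennreal ?a * esparse (S \<sigma>) G x \<le> (\<Sum>\<sigma>\<in>Pow Basis. ennreal ?a * esparse (S \<sigma>) G x)"
      using \<sigma> by (intro member_le_sum) auto
    with le[of \<sigma> n x] show "eavg (shifted.cell \<sigma> n x) G \<le> (\<Sum>\<sigma>\<in>Pow Basis. ennreal ?a * esparse (S \<sigma>) G x)"
      by (rule order_trans)
  qed
  then have "norm_le (dyadic_max G) ((2 * K) ^ card (Pow (Basis :: 'a set)) * (?a * (C * b)))"
    by (intro norm_le_mono[OF sum] borel_measurable_dyadic_max AE_I2)
  moreover have "(2 * K) ^ card (Pow (Basis :: 'a set)) * (?a * (C * b)) \<le> B * b"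
  proof -
    have "(2 * K) ^ card (Pow (Basis :: 'a set)) * (?a * C) * b \<le> B * b"
      using b unfolding B_def by (intro mult_right_mono) auto
    then show ?thesis by (simp only: mult.assoc)
  qed
  ultimately show ?thesis by (rule norm_le_weaken)
qed

lemma B_ge_1: "B \<ge> 1" by (simp add: B_def)

lemma norm_le_dyadic_max_iter:
  assumes "norm_le G b" "b \<ge> 0"
  shows "norm_le ((dyadic_max ^^ k) G) (B ^ k * b)"
proof (induction k)
  case (Suc k)
  have "norm_le (dyadic_max ((dyadic_max ^^ k) G)) (B * (B ^ k * b))"
    using Suc assms(2) B_ge_1 by (intro norm_le_dyadic_max) auto
  then show ?case by (simp add: mult.assoc)
qed (simp add: assms)

text \<open>Rubio de Francia iteration: the weights make the \<open>k\<close>-th term of size \<open>(2 * K) ^ -k\<close>, which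
  absorbs the factor \<open>K ^ k\<close> lost in the iterated quasi-triangle inequality.\<close>

lemma A1_majorant:
  assumes "norm_le G b" "b \<ge> 0"
  obtains w where "norm_le w (2 * K\<^sup>2 * b)" "\<And>x. G x \<le> w x" "\<And>x. dyadic_max w x \<le> ennreal (2 * K * B) * w x"
proof -
  define \<gamma> where "\<gamma> = 1 / (2 * K * B)"
  have KB: "K \<ge> 1" "B \<ge> 1" using K_ge_1 B_ge_1 by auto
  have \<gamma>: "\<gamma> > 0" using KB by (simp add: \<gamma>_def)
  define M where "M k = (dyadic_max ^^ k) G" for k
  define F where "F k x = ennreal (\<gamma> ^ k) * M k x" for k x
  define w where "w x = (\<Sum>k. F k x)" for x
  have M: "norm_le (M k) (B ^ k * b)" for k unfolding M_def by (rule norm_le_dyadic_max_iter[OF assms])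
  have F: "norm_le (F k) (b * (1 / (2 * K)) ^ k)" for k
  proof -
    have "norm_le (F k) (\<gamma> ^ k * (B ^ k * b))"
      unfolding F_def using \<gamma> by (intro norm_le_cmult M) auto
    moreover have "\<gamma> * B = 1 / (2 * K)" using KB by (simp add: \<gamma>_def)
    then have "\<gamma> ^ k * (B ^ k * b) = b * (1 / (2 * K)) ^ k"
      by (simp only: power_mult_distrib[symmetric] mult.assoc[symmetric]) simp
    ultimately show ?thesis by simp
  qed
  show ?thesis
  proof
    show "norm_le w (2 * K\<^sup>2 * b)" unfolding w_def using F assms(2) by (rule norm_le_suminf)
    show "G x \<le> w x" for x
    proof -
      have "G x = (\<Sum>k<1. F k x)" by (simp add: F_def M_def)
      also have "\<dots> \<le> w x" unfolding w_def by (intro sum_le_suminf) auto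
      finally show ?thesis .
    qed
    show "dyadic_max w x \<le> ennreal (2 * K * B) * w x" for x
    proof -
      have "dyadic_max w x \<le> (\<Sum>k. ennreal (\<gamma> ^ k) * dyadic_max (M k) x)"
        unfolding w_def[abs_def] F_def by (rule dyadic_max_suminf) (rule norm_leD(1)[OF M])
      \<comment> \<open>Applying \<open>dyadic_max\<close> shifts the series by one index, at the
        price of the factor \<open>1 / \<gamma>\<close>.\<close>
      also have "\<dots> = (\<Sum>k. ennreal (2 * K * B) * F (Suc k) x)"
      proof (intro suminf_cong)
        fix k
        have "2 * K * B * \<gamma> ^ Suc k = \<gamma> ^ k" using KB by (simp add: \<gamma>_def)
        then have "ennreal (\<gamma> ^ k) = ennreal (2 * K * B) * ennreal (\<gamma> ^ Suc k)"
          using KB \<gamma> by (simp flip: ennreal_mult)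
        then show "ennreal (\<gamma> ^ k) * dyadic_max (M k) x = ennreal (2 * K * B) * F (Suc k) x"
          by (simp add: F_def M_def mult.assoc)
      qed
      also have "\<dots> = ennreal (2 * K * B) * (\<Sum>k. F (Suc k) x)" by simp
      also have "(\<Sum>k. F (Suc k) x) \<le> w x"
        unfolding w_def using suminf_offset[of "\<lambda>k. F k x" 1] by simp
      finally show ?thesis by (simp add: mult_left_mono)
    qed
  qed
qed

text \<open>The grid with offset \<open>a\<close> at every scale and mesh \<open>h\<close> at level
  0 contains \<open>Q\<close> as a closed cube. The comparison with the shifted grids supplies its
  A1 condition with the extra factor \<open>6 ^ DIM('a)\<close>.\<close>

lemma reverse_holder_cube:
  assumes w: "norm_le w b" and A1: "\<And>x. dyadic_max w x \<le> ennreal (2 * K * B) * w x" and Q: "Q \<in> cubes"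
    and \<delta>: "\<delta> > 0" "(2 ^ (DIM('a) + 1)) powr \<delta> * (2 - 1 / (2 * (6 ^ DIM('a) * (2 * K * B)))) \<le> 2"
  shows "eavg Q w < \<infinity>"
    "eavg Q (\<lambda>y. ennreal (enn2real (w y) powr (1 + \<delta>))) \<le> ennreal (2 * enn2real (eavg Q w) powr (1 + \<delta>))"
proof -
  obtain a h where h: "h > 0" and Qa: "Q = cbox a (a + h *\<^sub>R One)" using Q by (auto simp: cubes_def)
  interpret L: dyadic_grid "\<lambda>n. h * 2 powr (of_int n)" "\<lambda>n i. a \<bullet> i"
  proof
    show "0 < h * 2 powr real_of_int n" for n using h by simp
    show "h * 2 powr real_of_int (n + 1) = 2 * (h * 2 powr real_of_int n)" for n by (simp add: powr_add)
    show "\<exists>j::int. a \<bullet> i - a \<bullet> i = real_of_int j * (h * 2 powr real_of_int n)" for n and i :: 'a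
      by (rule exI[of _ 0]) simp
  qed
  have "L.corner 0 a = a" by (simp add: L.corner_def L.idx_def euclidean_representation)
  then have Q_cube: "Q = L.cube 0 a" by (simp add: Qa L.cube_def)
  have KB: "1 \<le> 2 * K * B" using K_ge_1 B_ge_1 mult_mono[of 1 K 1 B] by simp
  have fin: "eavg (L.cell 0 a) w < \<infinity>"
    by (rule L.eavg_cell_finite) (rule norm_leD(2)[OF norm_le_esparse[OF w]])
  have A1': "eavg (L.cell m y) w \<le> ennreal (6 ^ DIM('a) * (2 * K * B)) * w y" for m y
  proof -
    have "eavg (L.cell m y) w \<le> ennreal (6 ^ DIM('a)) * dyadic_max w y"
      by (rule L.eavg_cell_le_dyadic_max)
    also have "\<dots> \<le> ennreal (6 ^ DIM('a)) * (ennreal (2 * K * B) * w y)"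
      using A1 by (rule mult_left_mono) simp
    also have "\<dots> = ennreal (6 ^ DIM('a) * (2 * K * B)) * w y"
      using KB by (simp add: ennreal_mult mult.assoc)
    finally show ?thesis .
  qed
  have "(1::real) * 1 \<le> 6 ^ DIM('a) * (2 * K * B)"
    using KB by (intro mult_mono) auto
  then have ge1: "(1::real) \<le> 6 ^ DIM('a) * (2 * K * B)" by simp
  show "eavg Q w < \<infinity>" using fin by (simp add: Q_cube L.eavg_cube)
  show "eavg Q (\<lambda>y. ennreal (enn2real (w y) powr (1 + \<delta>))) \<le> ennreal (2 * enn2real (eavg Q w) powr (1 + \<delta>))"
    unfolding Q_cube L.eavg_cube
    by (rule L.reverse_holder[OF norm_leD(1)[OF w] norm_leD(2)[OF w] A1' ge1 fin \<delta>])
qed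

text \<open>The 4 is the 2 of the reverse Hoelder inequality times the 2 in the norm bound
  \<open>2 * K\<^sup>2 * nX g\<close> of the A1 majorant.\<close>

lemma Asparse_bound_pow:
  assumes \<delta>: "\<delta> > 0" "(2 ^ (DIM('a) + 1)) powr \<delta> * (2 - 1 / (2 * (6 ^ DIM('a) * (2 * K * B)))) \<le> 2"
    and r: "r = 1 + \<delta>"
  shows "Asparse_bound (pow_space X r) (pow_norm nX r) ((4 * K\<^sup>2 * C) powr r)"
  unfolding Asparse_bound_def
proof (intro allI impI, elim conjE)
  fix S :: "'a set set" and f :: "'a \<Rightarrow> real" assume S: "sparse S" and f: "f \<in> pow_space X r"
  have r1: "r > 1" using \<delta> r by simp
  define g where "g x = \<bar>f x\<bar> powr (1 / r)" for x
  have fm[measurable]: "f \<in> borel_measurable lebesgue" and g: "g \<in> X"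
    using f by (auto simp: pow_space_def g_def[abs_def])
  have gm[measurable]: "g \<in> borel_measurable lebesgue" by (rule measurable_X[OF g])
  have "norm_le (\<lambda>x. ennreal (g x)) (nX g)"
    by (rule norm_le_dominated[OF g]) (auto simp: g_def)
  then obtain w where w: "norm_le w (2 * K\<^sup>2 * nX g)" and gw: "\<And>x. ennreal (g x) \<le> w x"
    and A1: "\<And>x. dyadic_max w x \<le> ennreal (2 * K * B) * w x"
    using A1_majorant norm_nonneg[OF g] by blast
  have f_le: "AE y in lebesgue. ennreal \<bar>f y\<bar> \<le> ennreal (enn2real (w y) powr (1 + \<delta>))"
    using norm_leD(2)[OF w]
  proof eventually_elim
    case (elim y)
    then have "ennreal (g y) \<le> ennreal (enn2real (w y))" using gw[of y] by simp
    then have "g y \<le> enn2real (w y)" by (subst (asm) ennreal_le_iff) simp_all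
    then have "g y powr r \<le> enn2real (w y) powr r" using r1 by (intro powr_mono2) (auto simp: g_def)
    moreover have "g y powr r = \<bar>f y\<bar>" using r1 by (simp add: g_def powr_powr)
    ultimately show ?case by (simp add: r ennreal_leI)
  qed
  define A where "A x = enn2real (esparse S w x)" for x
  have EA: "norm_le (esparse S w) (C * (2 * K\<^sup>2 * nX g))" by (rule norm_le_esparse[OF w S])
  have AX: "A \<in> X" and An: "nX A \<le> C * (2 * K\<^sup>2 * nX g)" using norm_leD[OF EA] by (auto simp: A_def[abs_def])
  have le: "AE x in lebesgue. sparse_op S f x \<le> ennreal (2 * A x powr r)"
    using norm_leD(2)[OF EA]
  proof eventually_elim
    case (elim x)
    have A: "esparse S w x = ennreal (A x)" "A x \<ge> 0" using elim by (simp_all add: A_def)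
    have "sparse_op S f x \<le> (\<integral>\<^sup>+ Q. ennreal (2 * A x powr \<delta>) * (eavg Q w * indicator Q x) \<partial>count_space S)"
      unfolding sparse_op_eq_esparse esparse_def
    proof (rule nn_integral_mono)
      fix Q assume "Q \<in> space (count_space S)"
      then have QS: "Q \<in> S" and Q: "Q \<in> cubes" using S by (auto simp: sparse_def)
      note rh = reverse_holder_cube[OF w A1 Q \<delta>]
      define c where "c = enn2real (eavg Q w)"
      have c: "eavg Q w = ennreal c" "c \<ge> 0" using rh(1) by (simp_all add: c_def)
      show "eavg Q (\<lambda>y. ennreal \<bar>f y\<bar>) * indicator Q x \<le> ennreal (2 * A x powr \<delta>) * (eavg Q w * indicator Q x)"
      proof (cases "x \<in> Q")
        case True
        \<comment> \<open>A single average is at most the whole sum at \<open>x\<close>. This turns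
          \<open>c powr (1 + \<delta>)\<close> into \<open>c\<close> times a factor independent of
          \<open>Q\<close>, so summing over \<open>Q\<close> only needs the sparse operator of
          \<open>w\<close>.\<close>
        have "ennreal c \<le> ennreal (A x)"
          using esparse_ge_single[OF QS True, of w] by (simp add: A c)
        then have cA: "c \<le> A x" using A by simp
        have "eavg Q (\<lambda>y. ennreal \<bar>f y\<bar>) \<le> ennreal (2 * c powr (1 + \<delta>))"
          using eavg_mono_AE[OF f_le] rh(2) unfolding c_def by (rule order_trans)
        also have "2 * c powr (1 + \<delta>) = 2 * c powr \<delta> * c"
          using c(2) by (cases "c = 0") (auto simp: powr_add)
        also have "ennreal \<dots> \<le> ennreal (2 * A x powr \<delta> * c)"
          using cA c(2) \<delta>(1) by (intro ennreal_leI mult_right_mono mult_left_mono powr_mono2) auto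
        also have "\<dots> = ennreal (2 * A x powr \<delta>) * eavg Q w"
          using c by (simp add: ennreal_mult)
        finally show ?thesis using True by simp
      qed simp
    qed
    also have "\<dots> = ennreal (2 * A x powr \<delta>) * esparse S w x"
      by (simp add: nn_integral_cmult esparse_def)
    also have "\<dots> = ennreal (2 * A x powr \<delta> * A x)"
      unfolding A(1) using A(2) by (simp add: ennreal_mult)
    also have "2 * A x powr \<delta> * A x = 2 * A x powr r"
      using A(2) by (cases "A x = 0") (auto simp: r powr_add)
    finally show ?case .
  qed
  define H where "H x = enn2real (sparse_op S f x)" for x
  have Hm[measurable]: "H \<in> borel_measurable lebesgue"
    unfolding H_def[abs_def] sparse_op_eq_esparse using borel_measurable_esparse[OF S] by measurable
  have H_le: "AE x in lebesgue. \<bar>\<bar>H x\<bar> powr (1 / r)\<bar> \<le> \<bar>2 * A x\<bar>"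
    using le
  proof eventually_elim
    case (elim x)
    have A: "A x \<ge> 0" by (simp add: A_def)
    have "0 \<le> H x" "H x \<le> 2 * A x powr r" using elim by (auto simp: H_def intro: enn2real_leI)
    then have "\<bar>H x\<bar> powr (1 / r) \<le> (2 * A x powr r) powr (1 / r)"
      using r1 by (intro powr_mono2) auto
    also have "\<dots> = 2 powr (1 / r) * A x" using r1 A by (simp add: powr_mult powr_powr)
    \<comment> \<open>Replacing \<open>2 powr (1 / r)\<close> by 2 frees the constant from
      \<open>r\<close>.\<close>
    also have "\<dots> \<le> 2 powr 1 * A x" using r1 A by (intro mult_right_mono powr_mono) auto
    finally show ?case using A by simp
  qed
  have HX: "(\<lambda>x. \<bar>H x\<bar> powr (1 / r)) \<in> X" and
    Hn: "nX (\<lambda>x. \<bar>H x\<bar> powr (1 / r)) \<le> nX (\<lambda>x. 2 * A x)"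
    by (rule ideal_X[OF scale_X[OF AX] _ H_le] norm_mono[OF scale_X[OF AX] _ H_le]; measurable)+
  have "nX (\<lambda>x. 2 * A x) \<le> 4 * K\<^sup>2 * C * nX g"
    using norm_scale[OF AX, of 2] An by (simp add: ac_simps)
  then have "nX (\<lambda>x. \<bar>H x\<bar> powr (1 / r)) powr r \<le> (4 * K\<^sup>2 * C * nX g) powr r"
    using Hn norm_nonneg[OF HX] r1 by (intro powr_mono2) auto
  also have "\<dots> = (4 * K\<^sup>2 * C) powr r * nX g powr r"
    using C_nonneg norm_nonneg[OF g] by (simp add: powr_mult)
  finally have "pow_norm nX r H \<le> (4 * K\<^sup>2 * C) powr r * pow_norm nX r f"
    by (simp add: pow_norm_def g_def[abs_def])
  moreover have "AE x in lebesgue. sparse_op S f x < \<infinity>"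
    using le by eventually_elim (auto intro: order.strict_trans1)
  moreover have "H \<in> pow_space X r" using HX Hm by (simp add: pow_space_def)
  ultimately show "(AE x in lebesgue. sparse_op S f x < \<infinity>) \<and>
      (\<lambda>x. enn2real (sparse_op S f x)) \<in> pow_space X r \<and>
      pow_norm nX r (\<lambda>x. enn2real (sparse_op S f x)) \<le> (4 * K\<^sup>2 * C) powr r * pow_norm nX r f"
    unfolding H_def[abs_def] by blast
qed

end

section \<open>Passing from admissible bounds to optimal constants\<close>

context qbfs
begin

lemma Asparse_bound_const:
  assumes "in_Asparse X nX"
  shows "Asparse_bound X nX (Asparse_const X nX)"
  unfolding Asparse_bound_def
proof (intro allI impI, elim conjE)
  fix S :: "'a set set" and f :: "'a \<Rightarrow> real" assume S: "sparse S" and f: "f \<in> X"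
  let ?A = "{C. Asparse_bound X nX C}" and ?h = "\<lambda>x. enn2real (sparse_op S f x)"
  have ne: "?A \<noteq> {}" using assms by (auto simp: in_Asparse_def)
  have all: "(AE x in lebesgue. sparse_op S f x < \<infinity>) \<and> ?h \<in> X \<and> nX ?h \<le> C * nX f" if "C \<in> ?A" for C
    using that S f unfolding Asparse_bound_def by blast
  obtain C0 where C0: "C0 \<in> ?A" using ne by blast
  have "nX ?h \<le> Inf ?A * nX f"
  proof (cases "nX f = 0")
    case True
    then show ?thesis using all[OF C0] by simp
  next
    case False
    then have pos: "nX f > 0" using norm_nonneg[OF f] by simp
    have "nX ?h / nX f \<le> Inf ?A"
      by (rule cInf_greatest[OF ne]) (use all pos in \<open>auto simp: divide_le_eq\<close>)
    then show ?thesis using pos by (simp add: divide_le_eq)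
  qed
  then show "(AE x in lebesgue. sparse_op S f x < \<infinity>) \<and> ?h \<in> X \<and> nX ?h \<le> Asparse_const X nX * nX f"
    using all[OF C0] by (simp add: Asparse_const_def)
qed

text \<open>Testing the empty family on \<open>\<bar>f\<bar> powr r\<close> suffices. The infimum
  defining the constant of the power space is thereby bounded below, and its \<open>powr\<close> is
  monotone.\<close>

lemma Asparse_bound_pow_nonneg:
  assumes "Asparse_bound (pow_space X r) (pow_norm nX r) C'" "r > 0"
  shows "C' \<ge> 0"
proof -
  obtain f where f: "f \<in> X" "nX f > 0" using X_nonempty by blast
  have fm[measurable]: "f \<in> borel_measurable lebesgue" by (rule measurable_X[OF f(1)])
  define h where "h x = \<bar>f x\<bar> powr r" for x
  have h_root: "\<bar>h x\<bar> powr (1 / r) = \<bar>f x\<bar>" for x using assms(2) by (simp add: h_def powr_powr)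
  have absX: "(\<lambda>x. \<bar>f x\<bar>) \<in> X" by (rule ideal_X[OF f(1)]) auto
  have "nX f \<le> nX (\<lambda>x. \<bar>f x\<bar>)" by (rule norm_mono[OF absX]) auto
  then have pos: "pow_norm nX r h > 0" using f(2) by (simp add: pow_norm_def h_root)
  have "h \<in> pow_space X r"
    unfolding pow_space_def mem_Collect_eq h_root using absX by (simp add: h_def[abs_def])
  then have "pow_norm nX r (\<lambda>x. enn2real (sparse_op {} h x)) \<le> C' * pow_norm nX r h"
    using assms(1) sparse_empty unfolding Asparse_bound_def by blast
  then have "0 \<le> C' * pow_norm nX r h"
    using powr_ge_zero unfolding pow_norm_def by (rule order_trans[rotated])
  then show ?thesis using pos by (simp add: zero_le_mult_iff)
qed

end

theorem theorem3p13:
  "\<exists>c :: real \<Rightarrow> real. \<forall>(X :: ('a::euclidean_space \<Rightarrow> real) set) nX.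
     qBFS X nX \<and> in_Asparse X nX \<longrightarrow>
     (\<exists>r0 > 1. \<forall>r. 1 < r \<and> r \<le> r0 \<longrightarrow>
        in_Asparse (pow_space X r) (pow_norm nX r) \<and>
        Asparse_const (pow_space X r) (pow_norm nX r) powr (1/r)
          \<le> c (KX X nX) * Asparse_const X nX)"
proof (intro exI[of _ "\<lambda>K. 4 * K\<^sup>2"] allI impI, elim conjE)
  fix X :: "('a \<Rightarrow> real) set" and nX assume X: "qBFS X nX" and Asp: "in_Asparse X nX"
  interpret qbfs X nX using X by unfold_locales
  define C where "C = Asparse_const X nX"
  interpret asparse_space X nX C
    using Asparse_bound_const[OF Asp] by unfold_locales (simp add: C_def)
  define L where "L = 6 ^ DIM('a) * (2 * K * B)"
  define b :: real where "b = 2 ^ (DIM('a) + 1)"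
  have b: "b > 1" unfolding b_def by (rule one_less_power) auto
  have "(1::real) * (2 * (1 * 1)) \<le> 6 ^ DIM('a) * (2 * (K * B))"
    using K_ge_1 B_ge_1 by (intro mult_mono) auto
  then have L: "L \<ge> 2" by (simp add: L_def mult.assoc)
  \<comment> \<open>The largest value of \<open>b powr (r - 1)\<close> permitted by the smallness
    condition on the exponent, which leads to \<open>r0 = 1 + log b t\<close>.\<close>
  define t where "t = 2 / (2 - 1 / (2 * L))"
  have t: "t > 1" "t * (2 - 1 / (2 * L)) = 2" and L': "2 - 1 / (2 * L) \<ge> 0"
    using L by (auto simp: t_def field_simps)
  show "\<exists>r0 > 1. \<forall>r. 1 < r \<and> r \<le> r0 \<longrightarrow>
        in_Asparse (pow_space X r) (pow_norm nX r) \<and>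
        Asparse_const (pow_space X r) (pow_norm nX r) powr (1/r)
          \<le> 4 * (KX X nX)\<^sup>2 * Asparse_const X nX"
  proof (intro exI[of _ "1 + log b t"] conjI allI impI; (elim conjE)?)
    show "1 < 1 + log b t" using b t by simp
    fix r :: real assume r: "1 < r" "r \<le> 1 + log b t"
    have "b powr (r - 1) \<le> b powr (log b t)" using b r by (intro powr_mono) auto
    also have "\<dots> = t" using b t by simp
    finally have "b powr (r - 1) * (2 - 1 / (2 * L)) \<le> t * (2 - 1 / (2 * L))"
      using L' by (rule mult_right_mono)
    then have "b powr (r - 1) * (2 - 1 / (2 * L)) \<le> 2" using t(2) by simp
    then have bd: "Asparse_bound (pow_space X r) (pow_norm nX r) ((4 * K\<^sup>2 * C) powr r)"
      using r(1) unfolding b_def L_def by (intro Asparse_bound_pow[of "r - 1"]) auto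
    then show "in_Asparse (pow_space X r) (pow_norm nX r)" by (auto simp: in_Asparse_def)
    let ?A = "{C'. Asparse_bound (pow_space X r) (pow_norm nX r) C'}"
    have nonneg: "C' \<ge> 0" if "C' \<in> ?A" for C' using that Asparse_bound_pow_nonneg r by auto
    have "Inf ?A \<le> (4 * K\<^sup>2 * C) powr r"
      using bd nonneg by (intro cInf_lower bdd_belowI[of _ 0]) auto
    moreover have "Inf ?A \<ge> 0" using bd nonneg by (intro cInf_greatest) auto
    ultimately have "Inf ?A powr (1 / r) \<le> ((4 * K\<^sup>2 * C) powr r) powr (1 / r)"
      using r by (intro powr_mono2) auto
    also have "\<dots> = 4 * K\<^sup>2 * C" using r C_nonneg by (simp add: powr_powr)
    finally show "Asparse_const (pow_space X r) (pow_norm nX r) powr (1/r)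
          \<le> 4 * (KX X nX)\<^sup>2 * Asparse_const X nX"
      by (simp add: Asparse_const_def C_def K_def)
  qed
qed

end
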